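(* For $5\le k\le 6$ we have $r_{\rm STam}(k,\mathbb{S}^2)=\arctan\frac34$, and any $k$-optimal TS-packing is a subfamily of a cuboctahedral TS-packing. Furthermore, for $7\le k\le 8$ we have $r_{\rm STam}(k,\mathbb{S}^2)=\arcsin\frac{1}{\sqrt3}$, and any $k$-optimal TS-packing is a subfamily of an octahedral TS-packing.
   Context: $\mathbb{S}^2$ is the unit sphere centered at the origin in Euclidean $3$-space. A great circle is the intersection of $\mathbb{S}^2$ with a plane through the origin. For $\mathbf{x}\in\mathbb{S}^2$ and $r\in(0,\frac{\pi}{2}]$, the (closed) spherical cap of center $\mathbf{x}$ and angular radius $r$ is $C[\mathbf{x},r]=\{\mathbf{y}\in\mathbb{S}^2:\langle\mathbf{y},\mathbf{x}\rangle\ge\cos r\}$. A packing of spherical caps is a family of caps with pairwise disjoint interiors. A totally separable packing (TS-packing) of $\mathbb{S}^2$ is a family of spherical caps such that any two of its caps can be separated by a great circle (i.e. they lie in different closed hemispheres bounded by it) which is disjoint from the interior of each cap in the family. For an integer $k>1$, $r_{\rm STam}(k,\mathbb{S}^2)$ denotes the largest $r>0$ such that there exists a TS-packing of $k$ spherical caps of angular radius $r$ in $\mathbb{S}^2$. A TS-packing of $k$ spherical caps of angular radius $r_{\rm STam}(k,\mathbb{S}^2)$ is called $k$-optimal. Octahedral TS-packing: three mutually orthogonal great circles divide the sphere into eight regular spherical triangles of side length $\frac{\pi}{2}$; the family of the eight inscribed spherical caps of these triangles (of radius $\arcsin\frac{1}{\sqrt3}$) is called an octahedral TS-packing. Cuboctahedral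 TS-packing: the three great circles containing the sides of a regular spherical triangle of side length $\arccos\frac14$ divide the sphere into two regular spherical triangles of side length $\arccos\frac14$ and six isosceles spherical triangles of side lengths $\pi-\arccos\frac14,\ \pi-\arccos\frac14,\ \arccos\frac14$; the family of the inscribed spherical caps of the six isosceles triangles (of radius $\arctan\frac34$) is called a cuboctahedral TS-packing. *)

theory Defs
  imports "HOL-Analysis.Analysis"
begin

type_synonym point = "real ^ 3"

abbreviation S2 :: "point set" where
  "S2 \<equiv> sphere 0 1"

text \<open>Great circles and closed hemispheres are given by a normal vector \<open>n\<close> of the plane; they are
  meant for \<open>n \<noteq> 0\<close> only. The two closed hemispheres bounded by \<open>great_circle n\<close> are
  \<open>hemisphere n\<close> and \<open>hemisphere (- n)\<close>.\<close>

definition great_circle :: "point \<Rightarrow> point set" where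
  "great_circle n = {y \<in> S2. n \<bullet> y = 0}"

definition hemisphere :: "point \<Rightarrow> point set" where
  "hemisphere n = {y \<in> S2. n \<bullet> y \<ge> 0}"

definition cap :: "point \<Rightarrow> real \<Rightarrow> point set" where
  "cap x r = {y \<in> S2. y \<bullet> x \<ge> cos r}"

definition cap_of_radius :: "real \<Rightarrow> point set \<Rightarrow> bool" where
  "cap_of_radius r C \<longleftrightarrow> 0 < r \<and> r \<le> pi / 2 \<and> (\<exists>x\<in>S2. C = cap x r)"

definition is_cap :: "point set \<Rightarrow> bool" where
  "is_cap C \<longleftrightarrow> (\<exists>r. cap_of_radius r C)"

definition cap_interior :: "point set \<Rightarrow> point set" where
  "cap_interior C = top_of_set S2 interior_of C"

text \<open>Disjointness of the interiors of distinct caps follows from the separation condition. An indexed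
  family satisfying that condition has no repeated caps, so sets of caps suffice. Which of \<open>C\<close>, \<open>D\<close>
  lies in \<open>hemisphere n\<close> is immaterial, as \<open>n\<close> may be replaced by \<open>- n\<close>.\<close>

definition ts_packing :: "point set set \<Rightarrow> bool" where
  "ts_packing F \<longleftrightarrow>
     (\<forall>C\<in>F. is_cap C) \<and>
     (\<forall>C\<in>F. \<forall>D\<in>F. C \<noteq> D \<longrightarrow>
        (\<exists>n. n \<noteq> 0 \<and> C \<subseteq> hemisphere n \<and> D \<subseteq> hemisphere (- n) \<and>
             (\<forall>E\<in>F. great_circle n \<inter> cap_interior E = {})))"

definition ts_packing_of :: "nat \<Rightarrow> real \<Rightarrow> point set set \<Rightarrow> bool" where
  "ts_packing_of k r F \<longleftrightarrow>
     ts_packing F \<and> finite F \<and> card F = k \<and> (\<forall>C\<in>F. cap_of_radius r C)"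

definition r_STam :: "nat \<Rightarrow> real" where
  "r_STam k = (GREATEST r. r > 0 \<and> (\<exists>F. ts_packing_of k r F))"

definition k_optimal :: "nat \<Rightarrow> point set set \<Rightarrow> bool" where
  "k_optimal k F \<longleftrightarrow> ts_packing_of k (r_STam k) F"

definition sph_dist :: "point \<Rightarrow> point \<Rightarrow> real" where
  "sph_dist a b = arccos (a \<bullet> b)"

text \<open>For non-antipodal \<open>a\<close>, \<open>b\<close> on the sphere, \<open>sph_hull {a, b}\<close> is the shorter great-circle arc
  joining them; for linearly independent \<open>a\<close>, \<open>b\<close>, \<open>c\<close>, \<open>sph_hull {a, b, c}\<close> is the spherical
  triangle with these vertices.\<close>

definition sph_hull :: "point set \<Rightarrow> point set" where
  "sph_hull A = S2 \<inter> convex_cone hull A"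

definition triangle_vertices :: "point \<Rightarrow> point \<Rightarrow> point \<Rightarrow> bool" where
  "triangle_vertices a b c \<longleftrightarrow>
     a \<in> S2 \<and> b \<in> S2 \<and> c \<in> S2 \<and> distinct [a, b, c] \<and> independent {a, b, c}"

text \<open>A cap contained in a spherical triangle and touching its three sides.\<close>

definition inscribed_cap :: "point set \<Rightarrow> point set \<Rightarrow> bool" where
  "inscribed_cap T C \<longleftrightarrow> is_cap C \<and>
     (\<exists>a b c. triangle_vertices a b c \<and> T = sph_hull {a, b, c} \<and> C \<subseteq> T \<and>
        C \<inter> sph_hull {a, b} \<noteq> {} \<and> C \<inter> sph_hull {b, c} \<noteq> {} \<and> C \<inter> sph_hull {c, a} \<noteq> {})"

text \<open>The closed regions into which the curves in \<open>G\<close> divide the sphere.\<close>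

definition regions :: "point set set \<Rightarrow> point set set" where
  "regions G = closure ` components (S2 - \<Union>G)"

definition octahedral :: "point set set \<Rightarrow> bool" where
  "octahedral F \<longleftrightarrow>
     (\<exists>u v w. u \<noteq> 0 \<and> v \<noteq> 0 \<and> w \<noteq> 0 \<and> u \<bullet> v = 0 \<and> v \<bullet> w = 0 \<and> w \<bullet> u = 0 \<and>
        F = {C. \<exists>T\<in>regions {great_circle u, great_circle v, great_circle w}. inscribed_cap T C})"

definition triangle_with_sides :: "real \<Rightarrow> real \<Rightarrow> real \<Rightarrow> point set \<Rightarrow> bool" where
  "triangle_with_sides l1 l2 l3 T \<longleftrightarrow>
     (\<exists>p q s. triangle_vertices p q s \<and> T = sph_hull {p, q, s} \<and>
        sph_dist p q = l1 \<and> sph_dist p s = l2 \<and> sph_dist q s = l3)"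

definition cuboctahedral :: "point set set \<Rightarrow> bool" where
  "cuboctahedral F \<longleftrightarrow>
     (\<exists>a b c u v w. triangle_vertices a b c \<and>
        sph_dist a b = arccos (1/4) \<and> sph_dist b c = arccos (1/4) \<and> sph_dist c a = arccos (1/4) \<and>
        u \<noteq> 0 \<and> v \<noteq> 0 \<and> w \<noteq> 0 \<and>
        sph_hull {b, c} \<subseteq> great_circle u \<and> sph_hull {c, a} \<subseteq> great_circle v \<and>
        sph_hull {a, b} \<subseteq> great_circle w \<and>
        F = {C. \<exists>T\<in>regions {great_circle u, great_circle v, great_circle w}.
               triangle_with_sides (pi - arccos (1/4)) (pi - arccos (1/4)) (arccos (1/4)) T \<and>
               inscribed_cap T C})"

end

theory Submission imports Defs begin

text \<open>
  A cap of radius \<open>r\<close> is determined by its centre, and a great circle with unit normal \<open>n\<close> misses the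
  interior of the cap around \<open>x\<close> exactly when \<open>\<bar>n \<bullet> x\<bar> \<ge> sin r\<close>. So with \<open>s = sin r\<close> a totally separable
  packing becomes a set \<open>X\<close> of unit vectors together with the set \<open>N\<close> of all unit vectors \<open>n\<close> such that
  \<open>\<bar>n \<bullet> x\<bar> \<ge> s\<close> on \<open>X\<close>; the separation condition says that any two points of \<open>X\<close> are given different
  signs by some \<open>n \<in> N\<close> (\<open>centres_of_ts_packing\<close>, \<open>ts_packing_of_centres\<close>). The question is how large a
  margin \<open>s\<close> the resulting sign matrix allows, as in the theory of margins of linear classifiers.

  Points are best considered up to sign. At most one point of \<open>X\<close> can have the sign pattern opposite to
  that of a given point, so five points contain three whose patterns differ even up to a global sign, and
  seven points contain four (\<open>exists_transverse\<close>). After replacing some of these vectors by their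
  opposites, only few sign matrices are left:

  \<^item> Three points yield three normals \<open>n\<^sub>1, n\<^sub>2, n\<^sub>3\<close> such that \<open>n\<^sub>i\<close> cuts \<open>x\<^sub>i\<close> off from the other two
    (\<open>transverse_imp_cut_apart\<close>). This forces \<open>s \<le> 3/5\<close> (\<open>cut_apart_bound\<close>).
  \<^item> Four points yield either three normals whose rows of signs have the same parity, which forces
    \<open>s\<^sup>2 \<le> 1/3\<close> (\<open>parity_bound\<close>), or two rows of each parity, which forces \<open>s\<^sup>2 < 1/3\<close>
    (\<open>mixed_parity_bound\<close>).

  Each bound is proved by a single sum of squares, a dual certificate for the margin problem, in which the
  unit vectors on one side are compared with weighted sums of those on the other side. In the first two cases the sum of
  squares vanishes in the case of equality, and this gives uniqueness: if \<open>s = 3/5\<close>, then the normals have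
  pairwise inner products \<open>-1/5\<close> and all centres are \<open>\<plusminus>((2/3)(n\<^sub>1 + n\<^sub>2 + n\<^sub>3) - n\<^sub>i)\<close>; if \<open>s\<^sup>2 = 1/3\<close>, then the
  normals are orthonormal and every centre has all three coordinates equal to \<open>\<plusminus>s\<close>. It then remains to
  recognise the caps around these centres as the inscribed caps of the spherical triangles cut out by the
  three great circles, and to write down extremal packings.
\<close>

section \<open>Margins of small sign matrices\<close>

definition cuts_off :: "real \<Rightarrow> 'a::real_inner \<Rightarrow> 'a \<Rightarrow> 'a \<Rightarrow> 'a \<Rightarrow> bool" where
  "cuts_off s n x y z \<longleftrightarrow> n \<bullet> x \<le> - s \<and> s \<le> n \<bullet> y \<and> s \<le> n \<bullet> z"

definition cut_apart :: "real \<Rightarrow> 'a::real_inner \<Rightarrow> 'a \<Rightarrow> 'a \<Rightarrow> 'a \<Rightarrow> 'a \<Rightarrow> 'a \<Rightarrow> bool" where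
  "cut_apart s n1 n2 n3 x1 x2 x3 \<longleftrightarrow>
     cuts_off s n1 x1 x2 x3 \<and> cuts_off s n2 x2 x1 x3 \<and> cuts_off s n3 x3 x1 x2"

lemmas inner_expand = inner_add_left inner_add_right inner_diff_left inner_diff_right

lemma unit_inner_bound:
  fixes x y :: "'a::real_inner"
  assumes "norm x = 1" "norm y = 1"
  shows "x \<bullet> y \<le> 1" "- 1 \<le> x \<bullet> y"
  using Cauchy_Schwarz_ineq2[of x y] assms by auto

lemma unit_inner_eq_1_imp_eq:
  fixes x y :: "'a::real_inner"
  assumes "norm x = 1" "norm y = 1" "x \<bullet> y = 1"
  shows "x = y"
proof -
  have "(x - y) \<bullet> (x - y) = 0"
    using assms by (simp add: inner_expand inner_commute norm_eq_1)
  then show ?thesis by simp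
qed

lemma power2_norm_diff_scaleR:
  fixes x z :: "'a::real_inner"
  assumes "norm x = 1"
  shows "(norm (z - c *\<^sub>R x))\<^sup>2 = z \<bullet> z - 2 * c * (z \<bullet> x) + c\<^sup>2"
  using assms unfolding power2_norm_eq_inner norm_eq_1
  by (simp add: inner_expand inner_commute power2_eq_square)

text \<open>The sign matrix has \<open>-1\<close> on the diagonal and \<open>1\<close> elsewhere. The matrix with diagonal entries \<open>-1/3\<close> and
off-diagonal entries \<open>2/3\<close> has the same signs and is orthogonal. Applied to the points, it therefore gives
vectors whose squared norms add up to 3 wherever the points lie, and comparing these vectors with the
normals bounds \<open>s\<close>. In the extremal case the normals coincide with them, so that the points are the images
of the normals under the same matrix, which is its own inverse. The conclusion speaks of \<open>x1\<close> only, because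
the hypotheses are symmetric.\<close>

lemma cut_apart_bound:
  fixes n1 n2 n3 x1 x2 x3 :: "'a::real_inner"
  assumes unit: "norm n1 = 1" "norm n2 = 1" "norm n3 = 1" "norm x1 = 1" "norm x2 = 1" "norm x3 = 1"
    and cut: "cut_apart s n1 n2 n3 x1 x2 x3"
  shows "s \<le> 3 / 5"
    and "s = 3 / 5 \<Longrightarrow>
      n1 \<bullet> n2 = - 1 / 5 \<and> n1 \<bullet> n3 = - 1 / 5 \<and> n2 \<bullet> n3 = - 1 / 5 \<and>
      x1 = (2 / 3) *\<^sub>R (n1 + n2 + n3) - n1"
proof -
  let ?w = "(2 / 3) *\<^sub>R (x1 + x2 + x3)"
  define D where "D = (norm (?w - x1 - n1))\<^sup>2 + (norm (?w - x2 - n2))\<^sup>2 + (norm (?w - x3 - n3))\<^sup>2"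
  have D: "3 * D = 18 - 4 * (n1 \<bullet> x2 + n1 \<bullet> x3 + n2 \<bullet> x1 + n2 \<bullet> x3 + n3 \<bullet> x1 + n3 \<bullet> x2)
      + 2 * (n1 \<bullet> x1 + n2 \<bullet> x2 + n3 \<bullet> x3)"
    using unit unfolding D_def power2_norm_eq_inner norm_eq_1
    by (simp add: inner_expand inner_commute algebra_simps)
  have ineqs: "n1 \<bullet> x1 \<le> - s" "s \<le> n1 \<bullet> x2" "s \<le> n1 \<bullet> x3" "n2 \<bullet> x2 \<le> - s" "s \<le> n2 \<bullet> x1"
    "s \<le> n2 \<bullet> x3" "n3 \<bullet> x3 \<le> - s" "s \<le> n3 \<bullet> x1" "s \<le> n3 \<bullet> x2"
    using cut by (auto simp: cut_apart_def cuts_off_def)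
  have "0 \<le> D" by (simp add: D_def)
  then show "s \<le> 3 / 5" using D ineqs by argo
  assume s: "s = 3 / 5"
  have "D = 0" and eqs: "n1 \<bullet> x1 = - 3/5" "n1 \<bullet> x2 = 3/5" "n1 \<bullet> x3 = 3/5" "n2 \<bullet> x2 = - 3/5" "n2 \<bullet> x3 = 3/5"
    using D ineqs \<open>0 \<le> D\<close> s by argo+
  then have n: "n1 = ?w - x1" "n2 = ?w - x2" "n3 = ?w - x3"
    unfolding D_def by (auto simp: add_nonneg_eq_0_iff)
  have "n1 + n2 + n3 = 3 *\<^sub>R ?w - (x1 + x2 + x3)"
    unfolding n by (simp add: algebra_simps scaleR_add_left[symmetric] flip: scaleR_2)
  also have "\<dots> = x1 + x2 + x3"
    by (simp flip: scaleR_left_diff_distrib add: scaleR_2)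
  finally have S: "x1 + x2 + x3 = n1 + n2 + n3" by simp
  have x: "x1 = (2 / 3) *\<^sub>R (n1 + n2 + n3) - n1" "x2 = (2 / 3) *\<^sub>R (n1 + n2 + n3) - n2"
    "x3 = (2 / 3) *\<^sub>R (n1 + n2 + n3) - n3"
    using n[unfolded S] by (metis add_diff_cancel_left' diff_add_cancel)+
  have "n1 \<bullet> n2 = - 1 / 5 \<and> n1 \<bullet> n3 = - 1 / 5 \<and> n2 \<bullet> n3 = - 1 / 5"
    using eqs unit unfolding x norm_eq_1 by (simp add: inner_expand inner_commute, argo)
  then show "n1 \<bullet> n2 = - 1 / 5 \<and> n1 \<bullet> n3 = - 1 / 5 \<and> n2 \<bullet> n3 = - 1 / 5 \<and>
      x1 = (2 / 3) *\<^sub>R (n1 + n2 + n3) - n1" using x by simp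
qed

text \<open>In all three rows of signs the number of minus signs is odd, and the rows are pairwise orthogonal vectors
of length 2. Hence the squared norms of the signed sums of the normals, one sum for each column, add up
to 12 whatever the normals are. If equality holds, then all signed sums of the normals have the same
length, which makes the normals orthogonal.\<close>

lemma parity_bound:
  fixes n1 n2 n3 x1 x2 x3 x4 :: "'a::real_inner"
  assumes unit: "norm n1 = 1" "norm n2 = 1" "norm n3 = 1"
      "norm x1 = 1" "norm x2 = 1" "norm x3 = 1" "norm x4 = 1"
    and cut: "cut_apart s n1 n2 n3 x1 x2 x3" "s \<le> n1 \<bullet> x4" "s \<le> n2 \<bullet> x4" "s \<le> n3 \<bullet> x4"
    and "0 < s"
  shows "s\<^sup>2 \<le> 1 / 3"
    and "s\<^sup>2 = 1 / 3 \<Longrightarrow> n1 \<bullet> n2 = 0 \<and> n1 \<bullet> n3 = 0 \<and> n2 \<bullet> n3 = 0"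
proof -
  define z1 z2 z3 z4 where z: "z1 = n2 + n3 - n1" "z2 = n1 + n3 - n2" "z3 = n1 + n2 - n3" "z4 = n1 + n2 + n3"
  \<comment> \<open>The factor \<open>3 s\<close> makes the differences vanish in the extremal case, where the sums have length \<open>sqrt 3\<close>.\<close>
  define D where "D = (norm (z1 - (3 * s) *\<^sub>R x1))\<^sup>2 + (norm (z2 - (3 * s) *\<^sub>R x2))\<^sup>2
    + (norm (z3 - (3 * s) *\<^sub>R x3))\<^sup>2 + (norm (z4 - (3 * s) *\<^sub>R x4))\<^sup>2"
  define m where "m = z1 \<bullet> x1 + z2 \<bullet> x2 + z3 \<bullet> x3 + z4 \<bullet> x4"
  have "D = (z1 \<bullet> z1 + z2 \<bullet> z2 + z3 \<bullet> z3 + z4 \<bullet> z4) - 6 * s * m + 36 * s\<^sup>2"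
    unfolding D_def m_def power2_norm_diff_scaleR[OF unit(4)] power2_norm_diff_scaleR[OF unit(5)]
      power2_norm_diff_scaleR[OF unit(6)] power2_norm_diff_scaleR[OF unit(7)]
    by (simp add: algebra_simps power2_eq_square)
  moreover have "z1 \<bullet> z1 + z2 \<bullet> z2 + z3 \<bullet> z3 + z4 \<bullet> z4 = 12"
    using unit unfolding z norm_eq_1 by (simp add: inner_expand inner_commute)
  ultimately have D: "D = 12 - 6 * s * m + 36 * s\<^sup>2" by simp
  have "12 * s \<le> m"
    using cut unfolding m_def z cut_apart_def cuts_off_def inner_expand by linarith
  then have "s * (12 * s) \<le> s * m" using \<open>0 < s\<close> by simp
  then have le: "D \<le> 12 - 36 * s\<^sup>2" unfolding D by (simp add: power2_eq_square mult.commute mult.left_commute)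
  moreover have "0 \<le> D" by (simp add: D_def)
  ultimately show "s\<^sup>2 \<le> 1 / 3" by linarith
  assume s: "s\<^sup>2 = 1 / 3"
  then have "D = 0" using le \<open>0 \<le> D\<close> by simp
  then have "z1 = (3 * s) *\<^sub>R x1" "z2 = (3 * s) *\<^sub>R x2" "z3 = (3 * s) *\<^sub>R x3" "z4 = (3 * s) *\<^sub>R x4"
    unfolding D_def by (auto simp: add_nonneg_eq_0_iff)
  then have "z1 \<bullet> z1 = 9 * s\<^sup>2" "z2 \<bullet> z2 = 9 * s\<^sup>2" "z3 \<bullet> z3 = 9 * s\<^sup>2" "z4 \<bullet> z4 = 9 * s\<^sup>2"
    using unit by (simp_all add: norm_eq_1 power2_eq_square)
  then show "n1 \<bullet> n2 = 0 \<and> n1 \<bullet> n3 = 0 \<and> n2 \<bullet> n3 = 0"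
    using unit unfolding z norm_eq_1 by (simp add: inner_expand inner_commute)
qed

text \<open>Here the first and the fourth row of signs are even and the other two are odd. Rows of different parity are not
orthogonal, and weights are needed: every row and every column of the weight matrix has two entries 1
and two entries 2. They are arranged such that the inner products of the weighted columns are 0 or
\<open>\<plusminus>1\<close>, so that the squared norms of the weighted sums of the points exceed \<open>40\<close> by at most 8. This would
give \<open>s\<^sup>2 \<le> 1/3\<close>, and the bound is strict because the extreme value 8 needs \<open>x1 = x4\<close>, while the first point and
the fourth one are separated.\<close>

lemma mixed_parity_bound:
  fixes n1 n2 n3 n4 x1 x2 x3 x4 :: "'a::real_inner"
  assumes unit: "norm n1 = 1" "norm n2 = 1" "norm n3 = 1" "norm n4 = 1"
      "norm x1 = 1" "norm x2 = 1" "norm x3 = 1" "norm x4 = 1"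
    and cut: "cut_apart s n1 n2 n3 x1 x2 x3" "n1 \<bullet> x4 \<le> - s" "s \<le> n2 \<bullet> x4" "s \<le> n3 \<bullet> x4"
      "s \<le> n4 \<bullet> x1" "s \<le> n4 \<bullet> x2" "n4 \<bullet> x3 \<le> - s" "n4 \<bullet> x4 \<le> - s"
    and "0 < s"
  shows "s\<^sup>2 < 1 / 3"
proof -
  \<comment> \<open>The rows of the weighted sign matrix, applied to the points.\<close>
  define y1 y2 y3 y4 where y: "y1 = 2 *\<^sub>R x2 + 2 *\<^sub>R x3 - x1 - x4" "y2 = 2 *\<^sub>R x1 + 2 *\<^sub>R x3 + x4 - x2"
    "y3 = x1 + 2 *\<^sub>R x2 + 2 *\<^sub>R x4 - x3" "y4 = 2 *\<^sub>R x1 + x2 - x3 - 2 *\<^sub>R x4"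
  \<comment> \<open>Subtracting \<open>c *\<^sub>R n\<close> four times gives a sum of squares with linear term \<open>- 2 * c * m\<close> and quadratic term
    \<open>4 * c\<^sup>2\<close>; for \<open>m = 24 * s\<close>, the least value of \<open>m\<close>, the minimum is at \<open>c = 6 * s\<close>.\<close>
  define D where "D = (norm (y1 - (6 * s) *\<^sub>R n1))\<^sup>2 + (norm (y2 - (6 * s) *\<^sub>R n2))\<^sup>2
    + (norm (y3 - (6 * s) *\<^sub>R n3))\<^sup>2 + (norm (y4 - (6 * s) *\<^sub>R n4))\<^sup>2"
  define m where "m = y1 \<bullet> n1 + y2 \<bullet> n2 + y3 \<bullet> n3 + y4 \<bullet> n4"
  have D: "D = (y1 \<bullet> y1 + y2 \<bullet> y2 + y3 \<bullet> y3 + y4 \<bullet> y4) - 12 * s * m + 144 * s\<^sup>2"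
    unfolding D_def m_def power2_norm_diff_scaleR[OF unit(1)] power2_norm_diff_scaleR[OF unit(2)]
      power2_norm_diff_scaleR[OF unit(3)] power2_norm_diff_scaleR[OF unit(4)]
    by (simp add: algebra_simps power2_eq_square)
  have yy: "y1 \<bullet> y1 + y2 \<bullet> y2 + y3 \<bullet> y3 + y4 \<bullet> y4
      = 40 + 2 * (x1 \<bullet> x4 - x1 \<bullet> x3 - x2 \<bullet> x3 - x2 \<bullet> x4)"
    using unit unfolding y norm_eq_1 by (simp add: inner_expand inner_commute)
  have "x1 \<noteq> x4" using cut \<open>0 < s\<close> by auto
  then have "x1 \<bullet> x4 < 1"
    using unit_inner_eq_1_imp_eq[of x1 x4] unit_inner_bound(1)[of x1 x4] unit by linarith
  then have "y1 \<bullet> y1 + y2 \<bullet> y2 + y3 \<bullet> y3 + y4 \<bullet> y4 < 48"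
    using yy unit_inner_bound(2)[OF unit(5,7)] unit_inner_bound(2)[OF unit(6,7)]
      unit_inner_bound(2)[OF unit(6,8)] by argo
  moreover have "24 * s \<le> m"
    using cut unfolding m_def y cut_apart_def cuts_off_def inner_expand inner_scaleR_left
    by (simp add: inner_commute)
  then have "s * (24 * s) \<le> s * m" using \<open>0 < s\<close> by simp
  then have "24 * s\<^sup>2 \<le> s * m" by (simp add: power2_eq_square)
  moreover have "0 \<le> D" by (simp add: D_def)
  ultimately show ?thesis using D by simp
qed

section \<open>From caps to centres and normals\<close>

lemma orthogonal_part:
  fixes n x :: "'a::real_inner"
  assumes "norm n = 1" "norm x = 1"
  defines "t \<equiv> x - (n \<bullet> x) *\<^sub>R n"
  shows "n \<bullet> t = 0" "(norm t)\<^sup>2 = 1 - (n \<bullet> x)\<^sup>2" "t \<bullet> x = (norm t)\<^sup>2"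
  using assms unfolding t_def power2_norm_eq_inner norm_eq_1
  by (simp_all add: inner_expand inner_commute power2_eq_square)

text \<open>This is the triangle inequality for angles, from \<open>n\<close> to \<open>x\<close> to \<open>y\<close>: the parts of \<open>n\<close> and \<open>y\<close> orthogonal to \<open>x\<close>
have norms at most \<open>cos r\<close> and \<open>sin r\<close>, so their inner product cannot outweigh that of the components along \<open>x\<close>.\<close>

lemma cap_subset_hemisphere:
  assumes "norm n = 1" "x \<in> S2" "0 < r" "r \<le> pi / 2" "sin r \<le> n \<bullet> x"
  shows "cap x r \<subseteq> hemisphere n"
proof
  fix y assume "y \<in> cap x r"
  then have y: "norm y = 1" "cos r \<le> x \<bullet> y" by (auto simp: cap_def inner_commute)
  have x: "norm x = 1" using assms by simp
  let ?a = "n - (x \<bullet> n) *\<^sub>R x" and ?b = "y - (x \<bullet> y) *\<^sub>R x"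
  note oa = orthogonal_part[OF x \<open>norm n = 1\<close>] and ob = orthogonal_part[OF x y(1)]
  have pos: "0 \<le> sin r" "0 \<le> cos r" using assms by (auto intro!: sin_ge_zero cos_ge_zero)
  have "(norm ?a)\<^sup>2 \<le> (cos r)\<^sup>2"
    using oa(2) power_mono[OF assms(5) pos(1), of 2] by (simp add: inner_commute cos_squared_eq)
  then have "norm ?a \<le> cos r" using pos(2) by (rule power2_le_imp_le)
  moreover have "(norm ?b)\<^sup>2 \<le> (sin r)\<^sup>2"
    using ob(2) power_mono[OF y(2) pos(2), of 2] by (simp add: inner_commute sin_squared_eq)
  then have "norm ?b \<le> sin r" using pos(1) by (rule power2_le_imp_le)
  ultimately have "norm ?a * norm ?b \<le> cos r * sin r" using pos by (intro mult_mono) auto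
  moreover have "sin r * cos r \<le> (x \<bullet> n) * (x \<bullet> y)"
    using assms(5) y(2) pos by (intro mult_mono) (auto simp: inner_commute)
  moreover have "n \<bullet> y = ?a \<bullet> ?b + (x \<bullet> n) * (x \<bullet> y)"
    using x unfolding norm_eq_1 by (simp add: inner_expand inner_commute)
  moreover have "- (norm ?a * norm ?b) \<le> ?a \<bullet> ?b"
    using Cauchy_Schwarz_ineq2[of ?a ?b] by linarith
  ultimately show "y \<in> hemisphere n"
    using y by (simp add: hemisphere_def mult.commute)
qed

text \<open>A point of the great circle leaves the hemisphere as soon as it is moved a little against \<open>n\<close>.\<close>

lemma great_circle_misses_interior_of_hemisphere_subset:
  assumes "n \<noteq> 0" "C \<subseteq> hemisphere n"
  shows "great_circle n \<inter> cap_interior C = {}"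
proof (rule ccontr)
  assume "great_circle n \<inter> cap_interior C \<noteq> {}"
  then obtain y T where y: "norm y = 1" "n \<bullet> y = 0" "y \<in> T" and T: "openin (top_of_set S2) T" "T \<subseteq> C"
    by (auto simp: great_circle_def cap_interior_def interior_of_def)
  obtain e where e: "0 < e" "\<And>z. z \<in> S2 \<Longrightarrow> dist z y < e \<Longrightarrow> z \<in> T"
    using T(1) \<open>y \<in> T\<close> unfolding openin_euclidean_subtopology_iff by blast
  let ?f = "\<lambda>t. sgn (y - t *\<^sub>R n)"
  have "(?f \<longlongrightarrow> sgn (y - 0 *\<^sub>R n)) (at_right 0)"
    using y by (intro tendsto_intros) auto
  then have "\<forall>\<^sub>F t in at_right 0. dist (?f t) y < e"
    using e(1) y by (simp add: tendsto_iff sgn_div_norm)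
  then obtain t where t: "0 < t" "dist (?f t) y < e"
    by (metis (no_types, lifting) eventually_at_right_field dense)
  have neg: "n \<bullet> (y - t *\<^sub>R n) < 0" using y t \<open>n \<noteq> 0\<close> by (simp add: inner_expand)
  then have nz: "y - t *\<^sub>R n \<noteq> 0" by auto
  then have "?f t \<in> hemisphere n" using e(2)[of "?f t"] t T(2) assms(2) by (auto simp: norm_sgn)
  then show False using neg nz
    by (auto simp: hemisphere_def sgn_div_norm zero_le_mult_iff)
qed

text \<open>The point of the great circle closest to \<open>x\<close> is the normalised orthogonal projection of \<open>x\<close>. Its
inner product with \<open>x\<close> is the norm of the projection, which exceeds \<open>cos r\<close> if \<open>n \<bullet> x\<close> is too small.\<close>

lemma great_circle_misses_cap_interior_imp:
  assumes "norm n = 1" "x \<in> S2" "0 < r" "r \<le> pi / 2" "great_circle n \<inter> cap_interior (cap x r) = {}"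
  shows "sin r \<le> \<bar>n \<bullet> x\<bar>"
proof (rule ccontr)
  assume "\<not> sin r \<le> \<bar>n \<bullet> x\<bar>"
  then have "\<bar>n \<bullet> x\<bar>\<^sup>2 < (sin r)\<^sup>2" by (intro power_strict_mono) auto
  have x: "norm x = 1" using assms by simp
  define t where "t = x - (n \<bullet> x) *\<^sub>R n"
  note o = orthogonal_part[OF \<open>norm n = 1\<close> x, folded t_def]
  have "0 \<le> cos r" using assms by (auto intro!: cos_ge_zero)
  have "(cos r)\<^sup>2 < (norm t)\<^sup>2" using o(2) \<open>\<bar>n \<bullet> x\<bar>\<^sup>2 < (sin r)\<^sup>2\<close> by (simp add: cos_squared_eq)
  then have c: "cos r < norm t" by (rule power_less_imp_less_base) simp
  with \<open>0 \<le> cos r\<close> have "t \<noteq> 0" by auto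
  have "sgn t \<bullet> x = norm t" using o(3) \<open>t \<noteq> 0\<close> by (simp add: sgn_div_norm power2_eq_square)
  moreover have "n \<bullet> sgn t = 0" using o(1) by (simp add: sgn_div_norm)
  ultimately have 1: "sgn t \<in> great_circle n" "cos r < sgn t \<bullet> x"
    using \<open>t \<noteq> 0\<close> c by (auto simp: great_circle_def norm_sgn)
  have "open {y. cos r < y \<bullet> x}" by (intro open_Collect_less continuous_intros)
  then have "openin (top_of_set S2) (S2 \<inter> {y. cos r < y \<bullet> x})" by (rule openin_open_Int)
  moreover have "S2 \<inter> {y. cos r < y \<bullet> x} \<subseteq> cap x r" by (auto simp: cap_def)
  ultimately have "S2 \<inter> {y. cos r < y \<bullet> x} \<subseteq> cap_interior (cap x r)"
    unfolding cap_interior_def by (rule interior_of_maximal[rotated])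
  then show False using 1 assms(5) by (auto simp: great_circle_def)
qed

text \<open>For \<open>s = sin r\<close> these are the unit normals of the great circles disjoint from the interiors of the caps of radius \<open>r\<close> around
the points of \<open>X\<close>.\<close>

definition avoiding_normals :: "real \<Rightarrow> 'a::real_inner set \<Rightarrow> 'a set" where
  "avoiding_normals s X = {n. norm n = 1 \<and> (\<forall>x\<in>X. s \<le> \<bar>n \<bullet> x\<bar>)}"

definition separated :: "real \<Rightarrow> 'a::real_inner set \<Rightarrow> bool" where
  "separated s X \<longleftrightarrow> (\<forall>x\<in>X. norm x = 1) \<and>
     (\<forall>x\<in>X. \<forall>y\<in>X. x \<noteq> y \<longrightarrow> (\<exists>n\<in>avoiding_normals s X. 0 < n \<bullet> x \<and> n \<bullet> y < 0))"

lemma separatedE: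
  assumes "separated s X" "x \<in> X" "y \<in> X" "x \<noteq> y"
  obtains n where "norm n = 1" "\<forall>z\<in>X. s \<le> \<bar>n \<bullet> z\<bar>" "0 < n \<bullet> x" "n \<bullet> y < 0"
  using assms unfolding separated_def avoiding_normals_def by blast

lemma centres_of_ts_packing:
  assumes "ts_packing_of k r F"
  obtains X where "finite X" "card X = k" "separated (sin r) X" "F = (\<lambda>x. cap x r) ` X"
proof -
  have F: "finite F" "card F = k" "\<And>C. C \<in> F \<Longrightarrow> cap_of_radius r C" "ts_packing F"
    using assms by (auto simp: ts_packing_of_def)
  obtain c where c: "\<And>C. C \<in> F \<Longrightarrow> c C \<in> S2 \<and> C = cap (c C) r"
    using F(3) unfolding cap_of_radius_def by metis
  have inj: "inj_on c F" using c by (metis inj_onI)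
  have "separated (sin r) (c ` F)"
    unfolding separated_def
  proof (intro conjI ballI impI)
    fix x y assume "x \<in> c ` F" "y \<in> c ` F" "x \<noteq> y"
    then obtain C D where CD: "C \<in> F" "D \<in> F" "x = c C" "y = c D" "C \<noteq> D" by auto
    then obtain n where n: "n \<noteq> 0" "C \<subseteq> hemisphere n" "D \<subseteq> hemisphere (- n)"
      "\<And>E. E \<in> F \<Longrightarrow> great_circle n \<inter> cap_interior E = {}"
      using F(4) unfolding ts_packing_def by metis
    have r: "0 < r" "r \<le> pi / 2" using F(3)[OF CD(1)] by (auto simp: cap_of_radius_def)
    have gc: "great_circle (sgn n) = great_circle n"
      using n(1) by (auto simp: great_circle_def sgn_div_norm)
    have "sin r \<le> \<bar>sgn n \<bullet> c E\<bar>" if "E \<in> F" for E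
      using great_circle_misses_cap_interior_imp[of "sgn n" "c E" r] r c[OF that] n(4)[OF that] n(1) gc
      by (simp add: norm_sgn)
    then have sn: "sgn n \<in> avoiding_normals (sin r) (c ` F)"
      using n(1) by (simp add: avoiding_normals_def norm_sgn)
    have "0 < sin r" using r by (intro sin_gt_zero) auto
    then have nz: "n \<bullet> c E \<noteq> 0" if "E \<in> F" for E
      using sn that by (force simp: avoiding_normals_def sgn_div_norm)
    have centre: "c E \<in> E" if "E \<in> F" for E
    proof -
      have "c E \<in> cap (c E) r" using c[OF that, THEN conjunct1] by (simp add: cap_def norm_eq_1)
      then show ?thesis using c[OF that] by metis
    qed
    have "0 \<le> n \<bullet> x" "n \<bullet> y \<le> 0"
      using centre[OF CD(1)] centre[OF CD(2)] n(2,3) CD(3,4) by (auto simp: hemisphere_def)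
    then have "0 < sgn n \<bullet> x \<and> sgn n \<bullet> y < 0"
      using nz[OF CD(1)] nz[OF CD(2)] CD(3,4) n(1)
      by (auto simp: sgn_div_norm zero_less_mult_iff mult_less_0_iff zero_less_divide_iff divide_less_0_iff)
    then show "\<exists>n\<in>avoiding_normals (sin r) (c ` F). 0 < n \<bullet> x \<and> n \<bullet> y < 0" using sn by blast
  qed (use c in auto)
  moreover have "F = (\<lambda>x. cap x r) ` c ` F" using c by (force simp: image_iff)
  ultimately show thesis using that[of "c ` F"] F(1,2) inj by (simp add: card_image)
qed

lemma ts_packing_of_centres:
  assumes X: "finite X" "card X = k" "separated (sin r) X" and r: "0 < r" "r \<le> pi / 2"
  shows "ts_packing_of k r ((\<lambda>x. cap x r) ` X)"
proof -
  have S: "x \<in> S2" if "x \<in> X" for x using X(3) that by (simp add: separated_def)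
  have "0 < sin r" using r by (intro sin_gt_zero) auto
  have cap: "cap_of_radius r (cap x r)" if "x \<in> X" for x
    using S[OF that] r by (auto simp: cap_of_radius_def)
  have sep: "\<exists>n. n \<noteq> 0 \<and> cap x r \<subseteq> hemisphere n \<and> cap y r \<subseteq> hemisphere (- n) \<and>
      (\<forall>z\<in>X. great_circle n \<inter> cap_interior (cap z r) = {})"
    if xy: "x \<in> X" "y \<in> X" "x \<noteq> y" for x y
  proof -
    obtain n where n: "norm n = 1" "\<forall>x\<in>X. sin r \<le> \<bar>n \<bullet> x\<bar>" "0 < n \<bullet> x" "n \<bullet> y < 0"
      using separatedE[OF X(3)] xy by metis
    have pos: "cap z r \<subseteq> hemisphere n" if "z \<in> X" "0 < n \<bullet> z" for z
      using that n(2) by (intro cap_subset_hemisphere n(1) S r) auto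
    have neg: "cap z r \<subseteq> hemisphere (- n)" if "z \<in> X" "n \<bullet> z < 0" for z
      using that n(1,2) by (intro cap_subset_hemisphere S r) auto
    have "great_circle n \<inter> cap_interior (cap z r) = {}" if "z \<in> X" for z
    proof (cases "0 < n \<bullet> z")
      case True
      then show ?thesis
        using pos[OF that] n(1) by (intro great_circle_misses_interior_of_hemisphere_subset) auto
    next
      case False
      then have "n \<bullet> z < 0" using n(2) that \<open>0 < sin r\<close> by force
      then have "great_circle (- n) \<inter> cap_interior (cap z r) = {}"
        using neg[OF that] n(1) by (intro great_circle_misses_interior_of_hemisphere_subset) auto
      then show ?thesis by (simp add: great_circle_def)
    qed
    moreover have "n \<noteq> 0" using n(1) by auto
    ultimately show ?thesis using pos[OF xy(1) n(3)] neg[OF xy(2) n(4)] by blast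
  qed
  have "inj_on (\<lambda>x. cap x r) X"
  proof (rule inj_onI, rule ccontr)
    fix x y assume xy: "x \<in> X" "y \<in> X" "cap x r = cap y r" "x \<noteq> y"
    obtain n where n: "norm n = 1" "\<forall>x\<in>X. sin r \<le> \<bar>n \<bullet> x\<bar>" "0 < n \<bullet> x" "n \<bullet> y < 0"
      using separatedE[OF X(3)] xy by metis
    have "cap y r \<subseteq> hemisphere (- n)"
      using xy(2) n by (intro cap_subset_hemisphere S r) auto
    moreover have "x \<in> cap x r" using S[OF xy(1)] by (simp add: cap_def norm_eq_1)
    ultimately show False using n(3) xy(3) by (auto simp: hemisphere_def)
  qed
  then have "card ((\<lambda>x. cap x r) ` X) = k" using X(2) by (simp add: card_image)
  moreover have "ts_packing ((\<lambda>x. cap x r) ` X)"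
    unfolding ts_packing_def
  proof (intro conjI ballI impI)
    fix C D assume "C \<in> (\<lambda>x. cap x r) ` X" "D \<in> (\<lambda>x. cap x r) ` X" "C \<noteq> D"
    then obtain x y where "x \<in> X" "y \<in> X" "x \<noteq> y" "C = cap x r" "D = cap y r" by blast
    then show "\<exists>n. n \<noteq> 0 \<and> C \<subseteq> hemisphere n \<and> D \<subseteq> hemisphere (- n) \<and>
        (\<forall>E\<in>(\<lambda>x. cap x r) ` X. great_circle n \<inter> cap_interior E = {})"
      using sep[of x y] by simp
  qed (use cap in \<open>auto simp: is_cap_def\<close>)
  ultimately show ?thesis
    using X(1) cap by (simp add: ts_packing_of_def)
qed

section \<open>Sign patterns of the centres\<close>

text \<open>Normals and points are both closed under \<open>x \<mapsto> - x\<close>, so that signs of rows and columns may be chosen freely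
when sign patterns are normalised.\<close>

definition margin_pair :: "real \<Rightarrow> 'a::real_inner set \<Rightarrow> 'a set \<Rightarrow> bool" where
  "margin_pair s N Y \<longleftrightarrow> 0 < s \<and> (\<forall>n\<in>N. norm n = 1 \<and> - n \<in> N) \<and> (\<forall>y\<in>Y. norm y = 1 \<and> - y \<in> Y) \<and>
     (\<forall>n\<in>N. \<forall>y\<in>Y. n \<bullet> y \<le> - s \<or> s \<le> n \<bullet> y)"

text \<open>The sign patterns of \<open>x\<close> and \<open>y\<close> are neither equal nor opposite; this is meant for sets of normals closed under negation.\<close>

definition transverse :: "'a::real_inner set \<Rightarrow> 'a \<Rightarrow> 'a \<Rightarrow> bool" where
  "transverse N x y \<longleftrightarrow> (\<exists>n\<in>N. 0 < n \<bullet> x \<and> 0 < n \<bullet> y) \<and> (\<exists>n\<in>N. 0 < n \<bullet> x \<and> n \<bullet> y < 0)"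

lemma margin_pair_avoiding_normals:
  assumes "separated s X" "0 < s"
  shows "margin_pair s (avoiding_normals s X) (X \<union> uminus ` X)"
  using assms unfolding margin_pair_def avoiding_normals_def separated_def
  by (auto simp: inner_minus_right)

lemma margin_pairD:
  assumes "margin_pair s N Y"
  shows "0 < s" "n \<in> N \<Longrightarrow> norm n = 1" "n \<in> N \<Longrightarrow> - n \<in> N" "y \<in> Y \<Longrightarrow> norm y = 1" "y \<in> Y \<Longrightarrow> - y \<in> Y"
    "n \<in> N \<Longrightarrow> y \<in> Y \<Longrightarrow> n \<bullet> y \<le> - s \<or> s \<le> n \<bullet> y"
  using assms by (auto simp: margin_pair_def)

text \<open>One of two opposite sign triples has at most one minus sign.\<close>

lemma margin_pair_sign_cases:
  assumes "margin_pair s N Y" "n1 \<in> N" "n2 \<in> N" "n3 \<in> N" "y \<in> Y"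
  shows "\<exists>z\<in>{y, - y}.
    s \<le> n1 \<bullet> z \<and> s \<le> n2 \<bullet> z \<and> s \<le> n3 \<bullet> z \<or> n1 \<bullet> z \<le> - s \<and> s \<le> n2 \<bullet> z \<and> s \<le> n3 \<bullet> z \<or>
    s \<le> n1 \<bullet> z \<and> n2 \<bullet> z \<le> - s \<and> s \<le> n3 \<bullet> z \<or> s \<le> n1 \<bullet> z \<and> s \<le> n2 \<bullet> z \<and> n3 \<bullet> z \<le> - s"
proof -
  have "s \<le> n \<bullet> (- y) \<longleftrightarrow> n \<bullet> y \<le> - s" "n \<bullet> (- y) \<le> - s \<longleftrightarrow> s \<le> n \<bullet> y" for n
    by auto
  moreover have "n1 \<bullet> y \<le> - s \<or> s \<le> n1 \<bullet> y" "n2 \<bullet> y \<le> - s \<or> s \<le> n2 \<bullet> y" "n3 \<bullet> y \<le> - s \<or> s \<le> n3 \<bullet> y"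
    using margin_pairD(6)[OF assms(1) _ assms(5)] assms(2-4) by blast+
  ultimately show ?thesis by simp (elim disjE; simp)
qed

lemma transverse_uminus:
  assumes "\<And>n. n \<in> N \<Longrightarrow> - n \<in> N" "transverse N x y"
  shows "transverse N (- x) y" "transverse N x (- y)"
proof -
  obtain n m where nm: "n \<in> N" "0 < n \<bullet> x" "0 < n \<bullet> y" "m \<in> N" "0 < m \<bullet> x" "m \<bullet> y < 0"
    using assms(2) by (auto simp: transverse_def)
  then have "- n \<in> N" "- m \<in> N" using assms(1) by auto
  with nm show "transverse N (- x) y" "transverse N x (- y)"
    unfolding transverse_def
    by (auto intro: bexI[of _ n] bexI[of _ m] bexI[of _ "- n"] bexI[of _ "- m"])
qed

text \<open>A point of \<open>X\<close> that is not transverse to \<open>a\<close> is \<open>a\<close> itself or has the sign pattern opposite to that of \<open>a\<close>. Two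
points with the same sign pattern are equal, since distinct points are separated. So each point of \<open>A\<close>
rules out at most two points.\<close>

lemma exists_transverse:
  assumes "separated s X" "0 < s" "finite X" "A \<subseteq> X" "2 * card A < card X"
  shows "\<exists>x\<in>X. \<forall>a\<in>A. transverse (avoiding_normals s X) a x"
proof (rule ccontr)
  let ?N = "avoiding_normals s X"
  define bad where "bad a = {x\<in>X. \<not> transverse ?N a x}" for a
  have nz: "n \<bullet> x \<noteq> 0" if "n \<in> ?N" "x \<in> X" for n x
    using that \<open>0 < s\<close> by (force simp: avoiding_normals_def)
  have "finite A" using assms finite_subset by blast
  have "card (bad a) \<le> 2" if "a \<in> A" for a
  proof -
    have a: "a \<in> X" using that assms by blast
    have opp: "n \<bullet> x < 0" if "x \<in> bad a - {a}" "n \<in> ?N" "0 < n \<bullet> a" for x n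
    proof -
      have "x \<in> X" "x \<noteq> a" "\<not> transverse ?N a x" using that by (auto simp: bad_def)
      moreover from this have "\<exists>n\<in>?N. 0 < n \<bullet> a \<and> n \<bullet> x < 0"
        using assms(1) a by (auto simp: separated_def)
      ultimately have "\<not> 0 < n \<bullet> x" using that by (auto simp: transverse_def)
      then show ?thesis using nz[OF that(2) \<open>x \<in> X\<close>] by simp
    qed
    have "x = y" if xy: "x \<in> bad a - {a}" "y \<in> bad a - {a}" for x y
    proof (rule ccontr)
      assume "x \<noteq> y"
      then obtain n where n: "n \<in> ?N" "0 < n \<bullet> x" "n \<bullet> y < 0"
        using assms(1) xy unfolding separated_def bad_def by blast
      then have "- n \<in> ?N" by (simp add: avoiding_normals_def)
      then show False
        using opp[OF xy(1) n(1)] opp[OF xy(2) \<open>- n \<in> ?N\<close>] nz[OF n(1) a] n by fastforce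
    qed
    moreover have "finite (bad a)" using assms(3) by (simp add: bad_def)
    ultimately have "card (bad a - {a}) \<le> Suc 0" by (subst card_le_Suc0_iff_eq) auto
    then show ?thesis using card_Diff_singleton_if[of "bad a" a] by (auto split: if_splits)
  qed
  then have "(\<Sum>a\<in>A. card (bad a)) \<le> 2 * card A" using sum_bounded_above[of A "\<lambda>a. card (bad a)" 2] by simp
  assume "\<not> (\<exists>x\<in>X. \<forall>a\<in>A. transverse ?N a x)"
  then have "X \<subseteq> (\<Union>a\<in>A. bad a)" by (auto simp: bad_def)
  then have "card X \<le> card (\<Union>a\<in>A. bad a)"
    using assms(3) \<open>finite A\<close> by (intro card_mono) (auto simp: bad_def)
  also have "\<dots> \<le> (\<Sum>a\<in>A. card (bad a))" using \<open>finite A\<close> by (rule card_UN_le)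
  finally show False using \<open>(\<Sum>a\<in>A. card (bad a)) \<le> 2 * card A\<close> assms(5) by simp
qed

text \<open>Up to negation a row of signs on three points either cuts off one of them or is constant: four types.
Being transverse means for each of the six pairs of types that one of the two occurs, so at
most one type is missing. If only the constant type is missing, the claim holds; if the type cutting off \<open>u\<close> is
missing, replacing \<open>u\<close> by \<open>-u\<close> exchanges it with the constant type and the other two types with each other.\<close>

lemma transverse_imp_cut_apart:
  assumes mp: "margin_pair s N Y" and Y: "x \<in> Y" "y \<in> Y" "z \<in> Y"
    and tr: "transverse N x y" "transverse N x z" "transverse N y z"
  obtains n1 n2 n3 x' y' z' where "n1 \<in> N" "n2 \<in> N" "n3 \<in> N"
    "x' \<in> {x, - x}" "y' \<in> {y, - y}" "z' \<in> {z, - z}" "cut_apart s n1 n2 n3 x' y' z'"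
proof -
  note result = that and D = margin_pairD[OF mp]
  define T where "T u v w \<longleftrightarrow> (\<exists>n\<in>N. cuts_off s n u v w)" for u v w
  define T0 where "T0 \<longleftrightarrow> (\<exists>n\<in>N. s \<le> n \<bullet> x \<and> s \<le> n \<bullet> y \<and> s \<le> n \<bullet> z)"
  have T_commute: "T u v w \<longleftrightarrow> T u w v" for u v w by (auto simp: T_def cuts_off_def)
  have T_minus: "T u v w" if "n \<in> N" "s \<le> n \<bullet> u" "n \<bullet> v \<le> - s" "n \<bullet> w \<le> - s" for n u v w
    using that D(3)[OF that(1)] by (auto simp: T_def cuts_off_def intro!: bexI[of _ "- n"])
  have apart: "T u v w \<or> T v u w" if tr_uv: "transverse N u v" and uvw: "u \<in> Y" "v \<in> Y" "w \<in> Y" for u v w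
  proof -
    obtain n where n: "n \<in> N" "0 < n \<bullet> u" "n \<bullet> v < 0" using tr_uv by (auto simp: transverse_def)
    then show ?thesis
      using D(6)[OF n(1) uvw(1)] D(6)[OF n(1) uvw(2)] D(6)[OF n(1) uvw(3)] D(1) T_minus[OF n(1), of u v w]
      by (auto simp: T_def cuts_off_def)
  qed
  have together: "(\<exists>n\<in>N. s \<le> n \<bullet> u \<and> s \<le> n \<bullet> v \<and> s \<le> n \<bullet> w) \<or> T w u v"
    if tr_uv: "transverse N u v" and uvw: "u \<in> Y" "v \<in> Y" "w \<in> Y" for u v w
  proof -
    obtain n where n: "n \<in> N" "0 < n \<bullet> u" "0 < n \<bullet> v" using tr_uv by (auto simp: transverse_def)
    then show ?thesis
      using D(6)[OF n(1) uvw(1)] D(6)[OF n(1) uvw(2)] D(6)[OF n(1) uvw(3)] D(1)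
      by (auto simp: T_def cuts_off_def)
  qed
  have cases: "T x y z \<or> T y x z" "T x y z \<or> T z x y" "T y x z \<or> T z x y"
    "T0 \<or> T z x y" "T0 \<or> T y x z" "T0 \<or> T x y z"
    using apart[OF tr(1) Y] apart[OF tr(2) Y(1,3,2)] apart[OF tr(3) Y(2,3,1)]
      together[OF tr(1) Y] together[OF tr(2) Y(1,3,2)] together[OF tr(3) Y(2,3,1)]
      T_commute unfolding T0_def by blast+
  have collect: thesis if "T x' y' z'" "T y' x' z'" "T z' x' y'"
      "x' \<in> {x, - x}" "y' \<in> {y, - y}" "z' \<in> {z, - z}" for x' y' z'
  proof -
    obtain n1 n2 n3 where "n1 \<in> N" "n2 \<in> N" "n3 \<in> N"
      "cuts_off s n1 x' y' z'" "cuts_off s n2 y' x' z'" "cuts_off s n3 z' x' y'"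
      using \<open>T x' y' z'\<close> \<open>T y' x' z'\<close> \<open>T z' x' y'\<close> unfolding T_def by blast
    then show thesis using that(4-6) by (intro result) (simp_all add: cut_apart_def)
  qed
  have flip: "T (- u) v w \<and> T v (- u) w \<and> T w (- u) v"
    if odd_rows: "\<exists>n\<in>N. s \<le> n \<bullet> u \<and> s \<le> n \<bullet> v \<and> s \<le> n \<bullet> w" "T v u w" "T w u v" for u v w
  proof -
    obtain n m l where nml: "n \<in> N" "s \<le> n \<bullet> u" "s \<le> n \<bullet> v" "s \<le> n \<bullet> w"
      "m \<in> N" "cuts_off s m v u w" "l \<in> N" "cuts_off s l w u v"
      using odd_rows unfolding T_def by blast
    then have "cuts_off s n (- u) v w" "cuts_off s (- m) w (- u) v" "cuts_off s (- l) v (- u) w"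
      by (auto simp: cuts_off_def)
    then show ?thesis using nml D(3) unfolding T_def by blast
  qed
  consider "T x y z" "T y x z" "T z x y" | T0 "T x y z" "T y x z" | T0 "T x y z" "T z x y" | T0 "T y x z" "T z x y"
    using cases by blast
  then show thesis
  proof cases
    case 1
    then show thesis by (intro collect[of x y z]) auto
  next
    case 2
    then have "T (- z) x y \<and> T x (- z) y \<and> T y (- z) x"
      by (intro flip) (auto simp: T0_def T_commute)
    then show thesis by (intro collect[of x y "- z"]) (auto simp: T_commute)
  next
    case 3
    then have "T (- y) x z \<and> T x (- y) z \<and> T z (- y) x"
      by (intro flip) (auto simp: T0_def T_commute)
    then show thesis by (intro collect[of x "- y" z]) (auto simp: T_commute)
  next
    case 4
    then have "T (- x) y z \<and> T y (- x) z \<and> T z (- x) y"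
      by (intro flip) (auto simp: T0_def T_commute)
    then show thesis by (intro collect[of "- x" y z]) (auto simp: T_commute)
  qed
qed

text \<open>The common conclusion of all sign patterns of four points: the orthogonal normals are those of the three coordinate
planes in the extremal case.\<close>

definition octant_bound :: "real \<Rightarrow> 'a::real_inner set \<Rightarrow> bool" where
  "octant_bound s N \<longleftrightarrow> s\<^sup>2 \<le> 1 / 3 \<and>
     (s\<^sup>2 = 1 / 3 \<longrightarrow> (\<exists>n1\<in>N. \<exists>n2\<in>N. \<exists>n3\<in>N. n1 \<bullet> n2 = 0 \<and> n1 \<bullet> n3 = 0 \<and> n2 \<bullet> n3 = 0))"

lemma octant_boundI_parity:
  assumes "margin_pair s N Y" "x1 \<in> Y" "x2 \<in> Y" "x3 \<in> Y" "x4 \<in> Y" "n1 \<in> N" "n2 \<in> N" "n3 \<in> N"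
    and "cut_apart s n1 n2 n3 x1 x2 x3" "s \<le> n1 \<bullet> x4" "s \<le> n2 \<bullet> x4" "s \<le> n3 \<bullet> x4"
  shows "octant_bound s N"
  using parity_bound[of n1 n2 n3 x1 x2 x3 x4 s] margin_pairD[OF assms(1)] assms(2-)
  unfolding octant_bound_def by blast

text \<open>The first and the fourth point lie in the same of the eight triangles formed by the first three great
circles, and a fourth great circle separates them. According to the sides on which it leaves \<open>x2\<close> and \<open>x3\<close>, either
its row of signs and two of the other rows have equal parity, or there are two rows of each parity.\<close>

lemma octant_bound_fourth_point_beside_first:
  assumes mp: "margin_pair s N Y" and Y: "x1 \<in> Y" "x2 \<in> Y" "x3 \<in> Y" "x4 \<in> Y"
    and N: "n1 \<in> N" "n2 \<in> N" "n3 \<in> N"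
    and cut: "cut_apart s n1 n2 n3 x1 x2 x3" and x4: "cuts_off s n1 x4 x2 x3" "s \<le> n2 \<bullet> x4" "s \<le> n3 \<bullet> x4"
    and n4: "n4 \<in> N" "0 < n4 \<bullet> x1" "n4 \<bullet> x4 < 0"
  shows "octant_bound s N"
proof -
  note D = margin_pairD[OF mp]
  have n4': "s \<le> n4 \<bullet> x1" "n4 \<bullet> x4 \<le> - s"
    using D(6)[OF n4(1) Y(1)] D(6)[OF n4(1) Y(4)] D(1) n4 by linarith+
  have unit: "norm n1 = 1" "norm n2 = 1" "norm n3 = 1" "norm n4 = 1"
      "norm x1 = 1" "norm x2 = 1" "norm x3 = 1" "norm x4 = 1" using D(2,4) Y N n4 by auto
  have strict: "octant_bound s N" if "s\<^sup>2 < 1 / 3" using that by (auto simp: octant_bound_def)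
  note cut' = cut[unfolded cut_apart_def cuts_off_def] and x4' = x4[unfolded cuts_off_def]
  consider "s \<le> n4 \<bullet> x2" "s \<le> n4 \<bullet> x3" | "n4 \<bullet> x2 \<le> - s" "n4 \<bullet> x3 \<le> - s"
    | "s \<le> n4 \<bullet> x2" "n4 \<bullet> x3 \<le> - s" | "n4 \<bullet> x2 \<le> - s" "s \<le> n4 \<bullet> x3"
    using D(6)[OF n4(1) Y(2)] D(6)[OF n4(1) Y(3)] by blast
  then show ?thesis
  proof cases
    case 1
    show ?thesis
      using cut' x4' n4' 1
      by (intro octant_boundI_parity[OF mp Y(2,3,4,1) N(2,3) n4(1)]) (auto simp: cut_apart_def cuts_off_def)
  next
    case 2
    show ?thesis
      using cut' x4' n4' 2
      by (intro octant_boundI_parity[OF mp Y D(3)[OF n4(1)] N(2,3)]) (auto simp: cut_apart_def cuts_off_def)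
  next
    case 3
    show ?thesis
      using mixed_parity_bound[OF unit cut _ x4(2,3) n4'(1) 3 n4'(2) D(1)] x4' strict by blast
  next
    case 4
    have "cut_apart s n1 n3 n2 x1 x3 x2" using cut by (auto simp: cut_apart_def cuts_off_def)
    then show ?thesis
      using mixed_parity_bound[OF unit(1,3,2,4,5,7,6,8) _ _ x4(3,2) n4'(1) 4(2,1) n4'(2) D(1)] x4' strict by blast
  qed
qed

text \<open>Three of the points provide three great circles as in \<open>transverse_imp_cut_apart\<close>. Up to sign, the fourth
point lies in the one of the four pairs of opposite triangles that is still free, which is the case of equal parity, or
shares a triangle with one of the three points.\<close>

lemma four_transverse_imp_octant_bound:
  assumes mp: "margin_pair s N Y" and Y: "a \<in> Y" "b \<in> Y" "c \<in> Y" "d \<in> Y"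
    and tr: "transverse N a b" "transverse N a c" "transverse N b c"
      "transverse N a d" "transverse N b d" "transverse N c d"
  shows "octant_bound s N"
proof -
  note D = margin_pairD[OF mp]
  obtain n1 n2 n3 x1 x2 x3 where N: "n1 \<in> N" "n2 \<in> N" "n3 \<in> N"
    and x: "x1 \<in> {a, - a}" "x2 \<in> {b, - b}" "x3 \<in> {c, - c}" and cut: "cut_apart s n1 n2 n3 x1 x2 x3"
    using transverse_imp_cut_apart[OF mp Y(1-3) tr(1-3)] by metis
  have xY: "x1 \<in> Y" "x2 \<in> Y" "x3 \<in> Y" using x Y D(5) by auto
  have "transverse N x1 d" "transverse N x2 d" "transverse N x3 d"
    using x tr(4-6) transverse_uminus(1)[OF D(3)] by blast+
  then have tr': "transverse N x1 y" "transverse N x2 y" "transverse N x3 y" if "y \<in> {d, - d}" for y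
    using that transverse_uminus(2)[OF D(3)] by blast+
  obtain y where y: "y \<in> {d, - d}"
    and signs: "s \<le> n1 \<bullet> y \<and> s \<le> n2 \<bullet> y \<and> s \<le> n3 \<bullet> y \<or> n1 \<bullet> y \<le> - s \<and> s \<le> n2 \<bullet> y \<and> s \<le> n3 \<bullet> y \<or>
      s \<le> n1 \<bullet> y \<and> n2 \<bullet> y \<le> - s \<and> s \<le> n3 \<bullet> y \<or> s \<le> n1 \<bullet> y \<and> s \<le> n2 \<bullet> y \<and> n3 \<bullet> y \<le> - s"
    using margin_pair_sign_cases[OF mp N Y(4)] by blast
  have yY: "y \<in> Y" using y Y(4) D(5) by auto
  obtain m1 m2 m3 where m: "m1 \<in> N" "0 < m1 \<bullet> x1" "m1 \<bullet> y < 0"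
    "m2 \<in> N" "0 < m2 \<bullet> x2" "m2 \<bullet> y < 0" "m3 \<in> N" "0 < m3 \<bullet> x3" "m3 \<bullet> y < 0"
    using tr'[OF y] by (auto simp: transverse_def)
  note cut' = cut[unfolded cut_apart_def cuts_off_def]
  from signs consider "s \<le> n1 \<bullet> y" "s \<le> n2 \<bullet> y" "s \<le> n3 \<bullet> y" | "n1 \<bullet> y \<le> - s" "s \<le> n2 \<bullet> y" "s \<le> n3 \<bullet> y"
    | "s \<le> n1 \<bullet> y" "n2 \<bullet> y \<le> - s" "s \<le> n3 \<bullet> y" | "s \<le> n1 \<bullet> y" "s \<le> n2 \<bullet> y" "n3 \<bullet> y \<le> - s"
    by blast
  then show ?thesis
  proof cases
    case 1
    then show ?thesis by (rule octant_boundI_parity[OF mp xY yY N cut])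
  next
    case 2
    then show ?thesis
      using cut' by (intro octant_bound_fourth_point_beside_first[OF mp xY yY N cut _ _ _ m(1-3)])
        (auto simp: cuts_off_def)
  next
    case 3
    have "cut_apart s n2 n1 n3 x2 x1 x3" using cut' by (simp add: cut_apart_def cuts_off_def)
    with 3 show ?thesis
      using cut' by (intro octant_bound_fourth_point_beside_first[OF mp xY(2,1,3) yY N(2,1,3) _ _ _ _ m(4-6)])
        (auto simp: cuts_off_def)
  next
    case 4
    have "cut_apart s n3 n1 n2 x3 x1 x2" using cut' by (simp add: cut_apart_def cuts_off_def)
    with 4 show ?thesis
      using cut' by (intro octant_bound_fourth_point_beside_first[OF mp xY(3,1,2) yY N(3,1,2) _ _ _ _ m(7-9)])
        (auto simp: cuts_off_def)
  qed
qed

section \<open>Spherical triangles cut out by three great circles\<close>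

text \<open>The \<open>m\<^sub>i\<close> are inner normals of the sides of the triangle with vertices \<open>p\<close>, \<open>q\<close>, \<open>t\<close>: up to positive factors, the two
triples are dual bases.\<close>

definition triangle_frame :: "point \<Rightarrow> point \<Rightarrow> point \<Rightarrow> point \<Rightarrow> point \<Rightarrow> point \<Rightarrow> bool" where
  "triangle_frame m1 m2 m3 p q t \<longleftrightarrow> p \<in> S2 \<and> q \<in> S2 \<and> t \<in> S2 \<and>
     0 < m1 \<bullet> p \<and> m1 \<bullet> q = 0 \<and> m1 \<bullet> t = 0 \<and>
     m2 \<bullet> p = 0 \<and> 0 < m2 \<bullet> q \<and> m2 \<bullet> t = 0 \<and>
     m3 \<bullet> p = 0 \<and> m3 \<bullet> q = 0 \<and> 0 < m3 \<bullet> t"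

lemma triangle_frame_vertices:
  assumes "triangle_frame m1 m2 m3 p q t"
  shows "triangle_vertices p q t"
proof -
  note f = assms[unfolded triangle_frame_def]
  have "q \<noteq> t" "p \<noteq> q" "p \<noteq> t" "t \<noteq> 0" using f by auto
  moreover have "q \<notin> span {t}" using f by (auto simp: span_singleton)
  moreover have "p \<notin> span {q, t}"
  proof
    assume "p \<in> span {q, t}"
    then obtain k where "p - k *\<^sub>R q \<in> span {t}" by (auto simp: span_insert)
    then obtain l where "p - k *\<^sub>R q = l *\<^sub>R t" by (auto simp: span_singleton)
    then have "m1 \<bullet> (p - k *\<^sub>R q) = m1 \<bullet> (l *\<^sub>R t)" by simp
    then show False using f by (simp add: inner_expand)
  qed
  ultimately show ?thesis
    using f by (simp add: triangle_vertices_def independent_insert)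
qed

lemma triangle_frame_coordinates:
  assumes "triangle_frame m1 m2 m3 p q t"
  shows "y = (m1 \<bullet> y / (m1 \<bullet> p)) *\<^sub>R p + (m2 \<bullet> y / (m2 \<bullet> q)) *\<^sub>R q + (m3 \<bullet> y / (m3 \<bullet> t)) *\<^sub>R t"
proof -
  note f = assms[unfolded triangle_frame_def]
  have v: "independent {p, q, t}" "card {p, q, t} = 3"
    using triangle_frame_vertices[OF assms] by (auto simp: triangle_vertices_def)
  have "UNIV \<subseteq> span {p, q, t}"
    using v by (intro card_ge_dim_independent) (auto simp: dim_UNIV)
  then obtain a b c where y: "y = a *\<^sub>R p + b *\<^sub>R q + c *\<^sub>R t"
  proof -
    have "y \<in> span {p, q, t}" using \<open>UNIV \<subseteq> span {p, q, t}\<close> by auto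
    then obtain a where "y - a *\<^sub>R p \<in> span {q, t}" by (auto simp: span_insert)
    then obtain b where "y - a *\<^sub>R p - b *\<^sub>R q \<in> span {t}" by (auto simp: span_insert)
    then obtain c where "y - a *\<^sub>R p - b *\<^sub>R q = c *\<^sub>R t" by (auto simp: span_singleton)
    then have "y = a *\<^sub>R p + b *\<^sub>R q + c *\<^sub>R t" by (simp add: algebra_simps)
    then show thesis by (rule that)
  qed
  show ?thesis using f unfolding y by (simp add: inner_expand)
qed

lemma sph_hull_subset_hemisphere:
  assumes "\<And>a. a \<in> A \<Longrightarrow> 0 \<le> n \<bullet> a"
  shows "sph_hull A \<subseteq> hemisphere n"
proof -
  have "convex_cone hull A \<subseteq> {y. 0 \<le> n \<bullet> y}"
    using assms convex_cone_halfspace_ge by (intro hull_minimal) auto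
  then show ?thesis by (auto simp: sph_hull_def hemisphere_def)
qed

lemma sph_hull_subset_great_circle:
  assumes "\<And>a. a \<in> A \<Longrightarrow> n \<bullet> a = 0"
  shows "sph_hull A \<subseteq> great_circle n"
proof -
  have "sph_hull A \<subseteq> hemisphere n \<inter> hemisphere (- n)"
    using assms by (intro Int_greatest sph_hull_subset_hemisphere) auto
  then show ?thesis by (auto simp: great_circle_def hemisphere_def subset_iff intro: antisym)
qed

lemma in_sph_hull_two:
  assumes "y = b *\<^sub>R q + c *\<^sub>R t" "y \<in> S2" "0 \<le> b" "0 \<le> c"
  shows "y \<in> sph_hull {q, t}"
  using assms unfolding sph_hull_def
  by (simp add: convex_cone_hull_add convex_cone_hull_mul hull_inc)

lemma triangle_frame_sph_hull:
  assumes "triangle_frame m1 m2 m3 p q t"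
  shows "sph_hull {p, q, t} = hemisphere m1 \<inter> hemisphere m2 \<inter> hemisphere m3"
proof
  note f = assms[unfolded triangle_frame_def]
  show "sph_hull {p, q, t} \<subseteq> hemisphere m1 \<inter> hemisphere m2 \<inter> hemisphere m3"
    using f by (intro Int_greatest sph_hull_subset_hemisphere) auto
  show "hemisphere m1 \<inter> hemisphere m2 \<inter> hemisphere m3 \<subseteq> sph_hull {p, q, t}"
  proof
    fix y assume y: "y \<in> hemisphere m1 \<inter> hemisphere m2 \<inter> hemisphere m3"
    then have "0 \<le> m1 \<bullet> y / (m1 \<bullet> p)" "0 \<le> m2 \<bullet> y / (m2 \<bullet> q)" "0 \<le> m3 \<bullet> y / (m3 \<bullet> t)"
      using f by (auto simp: hemisphere_def)
    then have "(m1 \<bullet> y / (m1 \<bullet> p)) *\<^sub>R p + (m2 \<bullet> y / (m2 \<bullet> q)) *\<^sub>R q + (m3 \<bullet> y / (m3 \<bullet> t)) *\<^sub>R t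
        \<in> convex_cone hull {p, q, t}"
      by (intro convex_cone_hull_add convex_cone_hull_mul hull_inc) auto
    then show "y \<in> sph_hull {p, q, t}"
      using y triangle_frame_coordinates[OF assms, of y] by (auto simp: sph_hull_def hemisphere_def)
  qed
qed

lemma triangle_frame_side:
  assumes "triangle_frame m1 m2 m3 p q t" "y \<in> sph_hull {p, q, t}"
  shows "m1 \<bullet> y = 0 \<Longrightarrow> y \<in> sph_hull {q, t}" "m2 \<bullet> y = 0 \<Longrightarrow> y \<in> sph_hull {t, p}"
    "m3 \<bullet> y = 0 \<Longrightarrow> y \<in> sph_hull {p, q}"
proof -
  note f = assms(1)[unfolded triangle_frame_def]
  have y: "y \<in> S2" "0 \<le> m1 \<bullet> y" "0 \<le> m2 \<bullet> y" "0 \<le> m3 \<bullet> y"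
    using assms(2) unfolding triangle_frame_sph_hull[OF assms(1)] by (auto simp: hemisphere_def)
  have nn: "0 \<le> m1 \<bullet> y / (m1 \<bullet> p)" "0 \<le> m2 \<bullet> y / (m2 \<bullet> q)" "0 \<le> m3 \<bullet> y / (m3 \<bullet> t)"
    using y f by auto
  note c = triangle_frame_coordinates[OF assms(1), of y]
  show "y \<in> sph_hull {q, t}" if "m1 \<bullet> y = 0"
    using c that by (intro in_sph_hull_two[OF _ y(1) nn(2,3)]) simp
  show "y \<in> sph_hull {t, p}" if "m2 \<bullet> y = 0"
    using c that by (intro in_sph_hull_two[OF _ y(1) nn(3,1)]) (simp add: add.commute)
  show "y \<in> sph_hull {p, q}" if "m3 \<bullet> y = 0"
    using c that by (intro in_sph_hull_two[OF _ y(1) nn(1,2)]) simp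
qed

text \<open>The interior of the triangle is the radial image of a convex cone, hence connected, and by the
intermediate value theorem a connected set avoiding the three great circles cannot leave it. Its closure is
the triangle, since every point of the triangle can be pushed into the interior.\<close>

lemma triangle_frame_region:
  assumes "triangle_frame m1 m2 m3 p q t"
  shows "sph_hull {p, q, t} \<in> regions {great_circle m1, great_circle m2, great_circle m3}"
proof -
  note f = assms[unfolded triangle_frame_def]
  define M where "M = {m1, m2, m3}"
  define U where "U = {y \<in> S2. \<forall>m\<in>M. 0 < m \<bullet> y}"
  let ?R = "S2 - \<Union> {great_circle m1, great_circle m2, great_circle m3}"
  have R: "?R = {y \<in> S2. \<forall>m\<in>M. m \<bullet> y \<noteq> 0}" by (auto simp: great_circle_def M_def)
  define K where "K = {y. \<forall>m\<in>M. 0 < m \<bullet> y}"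
  have pqt: "p + q + t \<in> K" using f by (auto simp: K_def M_def inner_expand)
  have K0: "y \<noteq> 0" if "y \<in> K" for y using that by (auto simp: K_def M_def)
  have sgn_K: "sgn y \<in> U" if "y \<in> K" for y
    using that K0[OF that] by (auto simp: K_def U_def norm_sgn sgn_div_norm)
  have "U = sgn ` K"
  proof
    show "U \<subseteq> sgn ` K" by (force simp: U_def K_def image_iff sgn_div_norm)
  qed (use sgn_K in blast)
  moreover have "convex K"
  proof -
    have "K = (\<Inter>m\<in>M. {y. 0 < m \<bullet> y})" by (auto simp: K_def)
    then show ?thesis by (simp add: convex_INT convex_halfspace_gt)
  qed
  moreover have "continuous_on K sgn" using K0 by (intro continuous_on_sgn continuous_intros) auto
  ultimately have "connected U" by (simp add: connected_continuous_image convex_connected)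
  have "U \<in> components ?R"
    unfolding in_components_maximal
  proof (intro conjI allI impI)
    show "U \<noteq> {}" using sgn_K[OF pqt] by auto
    show "U \<subseteq> ?R" unfolding R by (auto simp: U_def)
    show "connected U" by fact
    fix E assume "E \<noteq> {} \<and> U \<subseteq> E \<and> E \<subseteq> ?R \<and> connected E"
    then have E: "U \<subseteq> E" "E \<subseteq> ?R" "connected E" by auto
    obtain u where u: "u \<in> U" using sgn_K[OF pqt] by blast
    have "y \<in> U" if "y \<in> E" for y
    proof -
      have "0 < m \<bullet> y" if m: "m \<in> M" for m
      proof (rule ccontr)
        assume "\<not> 0 < m \<bullet> y"
        have "connected ((\<lambda>y. m \<bullet> y) ` E)"
          using E(3) by (intro connected_continuous_image continuous_intros)
        moreover have "m \<bullet> y \<in> (\<lambda>y. m \<bullet> y) ` E" "m \<bullet> u \<in> (\<lambda>y. m \<bullet> y) ` E"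
          using \<open>y \<in> E\<close> u E(1) by auto
        moreover have "m \<bullet> y \<le> 0" "0 \<le> m \<bullet> u" using \<open>\<not> 0 < m \<bullet> y\<close> u m by (auto simp: U_def)
        ultimately have "0 \<in> (\<lambda>y. m \<bullet> y) ` E"
          by (auto simp: connected_iff_interval)
        then show False using E(2) m unfolding R by force
      qed
      moreover have "y \<in> S2" using that E(2) by auto
      ultimately show "y \<in> U" by (simp add: U_def)
    qed
    then show "E = U" using E(1) by blast
  qed
  moreover have "closure U = sph_hull {p, q, t}"
  proof
    have H: "sph_hull {p, q, t} = {y \<in> S2. \<forall>m\<in>M. 0 \<le> m \<bullet> y}"
      unfolding triangle_frame_sph_hull[OF assms] by (auto simp: hemisphere_def M_def)
    have "sph_hull {p, q, t} = S2 \<inter> (\<Inter>m\<in>M. {y. 0 \<le> m \<bullet> y})" unfolding H by auto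
    then have "closed (sph_hull {p, q, t})"
      by (auto intro!: closed_Int closed_INT closed_halfspace_ge)
    then show "closure U \<subseteq> sph_hull {p, q, t}"
      unfolding H by (intro closure_minimal) (auto simp: U_def less_imp_le)
    show "sph_hull {p, q, t} \<subseteq> closure U"
    proof
      fix y assume y: "y \<in> sph_hull {p, q, t}"
      let ?f = "\<lambda>e. sgn (y + e *\<^sub>R (p + q + t))"
      have "norm y = 1" using y by (simp add: H)
      then have "(?f \<longlongrightarrow> sgn (y + 0 *\<^sub>R (p + q + t))) (at_right 0)"
        by (intro tendsto_intros) auto
      then have "(?f \<longlongrightarrow> y) (at_right 0)" using \<open>norm y = 1\<close> by (simp add: sgn_div_norm)
      moreover have "?f e \<in> U" if "0 < e" for e
      proof (rule sgn_K)
        show "y + e *\<^sub>R (p + q + t) \<in> K"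
          using y pqt that by (auto simp: H K_def inner_expand[of _ y] inner_add_right[of _ y] intro!: add_nonneg_pos)
      qed
      then have "\<forall>\<^sub>F e in at_right 0. ?f e \<in> U"
        by (auto simp: eventually_at_right_field intro!: exI[of _ 1])
      then have "\<forall>\<^sub>F e in at_right 0. ?f e \<in> closure U"
        by (rule eventually_mono) (use closure_subset in blast)
      ultimately show "y \<in> closure U"
        by (intro Lim_in_closed_set[where f = ?f and F = "at_right 0"]) auto
    qed
  qed
  ultimately show ?thesis unfolding regions_def by (metis image_eqI)
qed

text \<open>If the centre has distance \<open>r\<close> from all three great circles, then the normalised projections of the centre to
their planes are the points where the cap touches the sides.\<close>

lemma triangle_frame_inscribed_cap:
  assumes frame: "triangle_frame m1 m2 m3 p q t"
    and unit: "norm m1 = 1" "norm m2 = 1" "norm m3 = 1" and x: "x \<in> S2" and r: "0 < r" "r < pi / 2"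
    and dist: "m1 \<bullet> x = sin r" "m2 \<bullet> x = sin r" "m3 \<bullet> x = sin r"
  shows "inscribed_cap (sph_hull {p, q, t}) (cap x r)"
proof -
  have sub: "cap x r \<subseteq> sph_hull {p, q, t}"
    unfolding triangle_frame_sph_hull[OF frame] using unit x r dist
    by (intro Int_greatest cap_subset_hemisphere) auto
  have touch: "\<exists>y\<in>cap x r. m \<bullet> y = 0" if m: "norm m = 1" "m \<bullet> x = sin r" for m
  proof -
    define u where "u = x - (m \<bullet> x) *\<^sub>R m"
    have "norm x = 1" using x by simp
    note o = orthogonal_part[OF m(1) \<open>norm x = 1\<close>, folded u_def]
    have "0 < cos r" using r by (intro cos_gt_zero) auto
    have "(norm u)\<^sup>2 = (cos r)\<^sup>2" using o(2) m(2) by (simp add: cos_squared_eq)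
    then have n: "norm u = cos r" using \<open>0 < cos r\<close> by (simp add: power2_eq_iff_nonneg)
    then have "sgn u \<bullet> x = cos r"
      using o(3) \<open>0 < cos r\<close> by (simp add: sgn_div_norm power2_eq_square del: inner_diff_left)
    moreover have "m \<bullet> sgn u = 0" "norm (sgn u) = 1"
      using o(1) n \<open>0 < cos r\<close> by (auto simp: sgn_div_norm)
    ultimately show ?thesis by (intro bexI[of _ "sgn u"]) (auto simp: cap_def)
  qed
  obtain y1 y2 y3 where y: "y1 \<in> cap x r" "m1 \<bullet> y1 = 0" "y2 \<in> cap x r" "m2 \<bullet> y2 = 0"
    "y3 \<in> cap x r" "m3 \<bullet> y3 = 0"
    using touch unit dist by metis
  have "y1 \<in> sph_hull {q, t}" "y2 \<in> sph_hull {t, p}" "y3 \<in> sph_hull {p, q}"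
    using triangle_frame_side[OF frame] sub y by auto
  moreover have "is_cap (cap x r)" using x r unfolding is_cap_def cap_of_radius_def by (auto intro!: exI[of _ r])
  ultimately show ?thesis
    unfolding inscribed_cap_def using triangle_frame_vertices[OF frame] sub y by blast
qed

section \<open>Recognising the octahedral and the cuboctahedral family\<close>

definition octahedral_family :: "point \<Rightarrow> point \<Rightarrow> point \<Rightarrow> point set set" where
  "octahedral_family n1 n2 n3 =
     {C. \<exists>T\<in>regions {great_circle n1, great_circle n2, great_circle n3}. inscribed_cap T C}"

lemma great_circle_scaleR_sign:
  assumes "\<bar>c\<bar> = 1"
  shows "great_circle (c *\<^sub>R n) = great_circle n"
  using assms by (auto simp: great_circle_def)

text \<open>By Bessel's inequality the three coordinates of \<open>x\<close> are exactly \<open>\<plusminus>1/sqrt 3\<close>. Changing the signs of the normals so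
that these coordinates become positive, the normals are themselves the vertices of the octant around \<open>x\<close>.\<close>

lemma cap_in_octahedral_family:
  assumes unit: "norm n1 = 1" "norm n2 = 1" "norm n3 = 1"
    and orth: "n1 \<bullet> n2 = 0" "n1 \<bullet> n3 = 0" "n2 \<bullet> n3 = 0"
    and s: "s = 1 / sqrt 3" and x: "norm x = 1" "s \<le> \<bar>n1 \<bullet> x\<bar>" "s \<le> \<bar>n2 \<bullet> x\<bar>" "s \<le> \<bar>n3 \<bullet> x\<bar>"
  shows "cap x (arcsin s) \<in> octahedral_family n1 n2 n3"
proof -
  have "0 < s" "s < 1" and s2: "s\<^sup>2 = 1 / 3" by (simp_all add: s power_divide)
  then have asn: "sin (arcsin s) = s" "0 < arcsin s" "arcsin s < pi / 2"
    using arcsin_less_arcsin[of 0 s] arcsin_lt_bounded[of s] by (auto simp: sin_arcsin)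
  have "(norm (x - (n1 \<bullet> x) *\<^sub>R n1 - (n2 \<bullet> x) *\<^sub>R n2 - (n3 \<bullet> x) *\<^sub>R n3))\<^sup>2
      = 1 - ((n1 \<bullet> x)\<^sup>2 + (n2 \<bullet> x)\<^sup>2 + (n3 \<bullet> x)\<^sup>2)"
    using unit orth x(1) unfolding power2_norm_eq_inner norm_eq_1
    by (simp add: inner_expand inner_commute power2_eq_square)
  then have bessel: "(n1 \<bullet> x)\<^sup>2 + (n2 \<bullet> x)\<^sup>2 + (n3 \<bullet> x)\<^sup>2 \<le> 1"
    using zero_le_power2[of "norm (x - (n1 \<bullet> x) *\<^sub>R n1 - (n2 \<bullet> x) *\<^sub>R n2 - (n3 \<bullet> x) *\<^sub>R n3)"] by linarith
  have "1 / 3 \<le> (n \<bullet> x)\<^sup>2" if "s \<le> \<bar>n \<bullet> x\<bar>" for n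
    using power_mono[OF that, of 2] \<open>0 < s\<close> s2 by simp
  note this[OF x(2)] this[OF x(3)] this[OF x(4)]
  then have "(n1 \<bullet> x)\<^sup>2 = s\<^sup>2" "(n2 \<bullet> x)\<^sup>2 = s\<^sup>2" "(n3 \<bullet> x)\<^sup>2 = s\<^sup>2"
    using bessel s2 by linarith+
  then have abs: "\<bar>n1 \<bullet> x\<bar> = s" "\<bar>n2 \<bullet> x\<bar> = s" "\<bar>n3 \<bullet> x\<bar> = s"
    using \<open>0 < s\<close> by (simp_all add: power2_eq_iff abs_if) linarith+
  define m1 m2 m3 where m: "m1 = sgn (n1 \<bullet> x) *\<^sub>R n1" "m2 = sgn (n2 \<bullet> x) *\<^sub>R n2" "m3 = sgn (n3 \<bullet> x) *\<^sub>R n3"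
  have sg: "\<bar>sgn (n1 \<bullet> x)\<bar> = 1" "\<bar>sgn (n2 \<bullet> x)\<bar> = 1" "\<bar>sgn (n3 \<bullet> x)\<bar> = 1"
    using abs \<open>0 < s\<close> by (auto simp: abs_sgn_eq)
  have mu: "norm m1 = 1" "norm m2 = 1" "norm m3 = 1" using unit sg by (simp_all add: m)
  have mo: "m1 \<bullet> m2 = 0" "m1 \<bullet> m3 = 0" "m2 \<bullet> m3 = 0" using orth by (simp_all add: m)
  have "triangle_frame m1 m2 m3 m1 m2 m3"
    using mu mo unfolding triangle_frame_def norm_eq_1 by (simp add: inner_commute norm_eq_1)
  moreover have "m1 \<bullet> x = s" "m2 \<bullet> x = s" "m3 \<bullet> x = s" using abs by (simp_all add: m mult.commute mult_sgn_abs flip: abs_sgn)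
  ultimately have "inscribed_cap (sph_hull {m1, m2, m3}) (cap x (arcsin s))"
      "sph_hull {m1, m2, m3} \<in> regions {great_circle m1, great_circle m2, great_circle m3}"
    using triangle_frame_inscribed_cap[of m1 m2 m3 m1 m2 m3 x "arcsin s"] triangle_frame_region mu x(1) asn
    by auto
  moreover have "great_circle m1 = great_circle n1" "great_circle m2 = great_circle n2" "great_circle m3 = great_circle n3"
    unfolding m using sg by (simp_all only: great_circle_scaleR_sign)
  ultimately show ?thesis unfolding octahedral_family_def by auto
qed

lemma sin_arctan_3_4: "sin (arctan (3/4)) = 3 / 5"
proof -
  have root: "sqrt (1 + (3/4)\<^sup>2) = 5 / 4" by (rule real_sqrt_unique) (simp_all add: power_divide)
  show ?thesis unfolding sin_arctan root by simp
qed

text \<open>The normals of the three great circles of a cuboctahedral packing, oriented towards the regular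
triangle.\<close>

definition equiangular :: "'a::real_inner \<Rightarrow> 'a \<Rightarrow> 'a \<Rightarrow> bool" where
  "equiangular n1 n2 n3 \<longleftrightarrow> norm n1 = 1 \<and> norm n2 = 1 \<and> norm n3 = 1 \<and>
     n1 \<bullet> n2 = - 1 / 5 \<and> n1 \<bullet> n3 = - 1 / 5 \<and> n2 \<bullet> n3 = - 1 / 5"

text \<open>Up to a positive factor, the first vector of the dual basis of an equiangular triple: a vertex of the regular triangle.\<close>

definition corner :: "'a::real_inner \<Rightarrow> 'a \<Rightarrow> 'a \<Rightarrow> 'a" where
  "corner n1 n2 n3 = (1 / sqrt (72 / 5)) *\<^sub>R (4 *\<^sub>R n1 + n2 + n3)"

definition cuboctahedral_family :: "point \<Rightarrow> point \<Rightarrow> point \<Rightarrow> point set set" where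
  "cuboctahedral_family n1 n2 n3 =
     {C. \<exists>T\<in>regions {great_circle n1, great_circle n2, great_circle n3}.
        triangle_with_sides (pi - arccos (1/4)) (pi - arccos (1/4)) (arccos (1/4)) T \<and> inscribed_cap T C}"

lemma equiangular_commute:
  assumes "equiangular n1 n2 n3"
  shows "equiangular n2 n1 n3" "equiangular n1 n3 n2" "equiangular n3 n1 n2"
  using assms by (auto simp: equiangular_def inner_commute)

lemma corner_inner:
  assumes "equiangular n1 n2 n3"
  shows "norm (corner n1 n2 n3) = 1" "0 < n1 \<bullet> corner n1 n2 n3"
    "n2 \<bullet> corner n1 n2 n3 = 0" "n3 \<bullet> corner n1 n2 n3 = 0"
    "corner n1 n2 n3 \<bullet> corner n2 n1 n3 = 1 / 4"
proof -
  have c: "(1 / sqrt (72 / 5)) * (1 / sqrt (72 / 5)) = (5 / 72 :: real)"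
    by (simp add: real_sqrt_mult_self flip: real_sqrt_mult)
  have "(4 *\<^sub>R n1 + n2 + n3) \<bullet> (4 *\<^sub>R n1 + n2 + n3) = 72 / 5" "(4 *\<^sub>R n1 + n2 + n3) \<bullet> (4 *\<^sub>R n2 + n1 + n3) = 18 / 5"
    using assms unfolding equiangular_def norm_eq_1 by (simp_all add: inner_expand inner_commute)
  then show "norm (corner n1 n2 n3) = 1" "corner n1 n2 n3 \<bullet> corner n2 n1 n3 = 1 / 4"
    using c unfolding corner_def norm_eq_1 inner_scaleR_left inner_scaleR_right
    by (simp_all flip: mult.assoc)
  show "0 < n1 \<bullet> corner n1 n2 n3" "n2 \<bullet> corner n1 n2 n3 = 0" "n3 \<bullet> corner n1 n2 n3 = 0"
    using assms unfolding equiangular_def norm_eq_1 corner_def by (simp_all add: inner_expand inner_commute)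
qed

lemma corner_commute: "corner n1 n3 n2 = corner n1 n2 n3"
  by (simp add: corner_def add.commute add.left_commute)

lemma exists_equiangular_frame:
  assumes eq: "equiangular n1 n2 n3"
  obtains a b c where "triangle_frame n1 n2 n3 a b c" "a \<bullet> b = 1 / 4" "a \<bullet> c = 1 / 4" "b \<bullet> c = 1 / 4"
proof -
  define a b c where abc: "a = corner n1 n2 n3" "b = corner n2 n1 n3" "c = corner n3 n1 n2"
  note ca = corner_inner[OF eq, folded abc]
    and cb = corner_inner[OF equiangular_commute(1)[OF eq], folded abc]
    and cc = corner_inner[OF equiangular_commute(3)[OF eq], folded abc]
  have ac: "a \<bullet> c = 1 / 4" "b \<bullet> c = 1 / 4"
    using corner_inner(5)[OF equiangular_commute(2)[OF eq]]
      corner_inner(5)[OF equiangular_commute(2)[OF equiangular_commute(1)[OF eq]]]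
    by (simp_all add: abc corner_commute)
  have "triangle_frame n1 n2 n3 a b c"
    using ca cb cc by (simp add: triangle_frame_def)
  then show thesis using ca(5) ac by (rule that)
qed

lemma cuboctahedral_cuboctahedral_family:
  assumes eq: "equiangular n1 n2 n3"
  shows "cuboctahedral (cuboctahedral_family n1 n2 n3)"
proof -
  obtain a b c where frame: "triangle_frame n1 n2 n3 a b c"
    and ab: "a \<bullet> b = 1 / 4" "a \<bullet> c = 1 / 4" "b \<bullet> c = 1 / 4"
    using exists_equiangular_frame[OF eq] by metis
  note f = frame[unfolded triangle_frame_def]
  have "sph_dist a b = arccos (1/4)" "sph_dist b c = arccos (1/4)" "sph_dist c a = arccos (1/4)"
    by (simp_all add: sph_dist_def ab inner_commute[of c a])
  moreover have "sph_hull {b, c} \<subseteq> great_circle n1" "sph_hull {c, a} \<subseteq> great_circle n2" "sph_hull {a, b} \<subseteq> great_circle n3"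
    using f by (intro sph_hull_subset_great_circle; auto)+
  moreover have "n1 \<noteq> 0" "n2 \<noteq> 0" "n3 \<noteq> 0" using eq by (auto simp: equiangular_def)
  ultimately show ?thesis
    unfolding cuboctahedral_def cuboctahedral_family_def
    using triangle_frame_vertices[OF frame] by blast
qed

text \<open>The isosceles triangle around the centre arises from the regular triangle by replacing the vertex \<open>a\<close>
with its antipode, which reverses \<open>n1\<close>. The sign \<open>e\<close> switches to the antipodal triangle.\<close>

lemma cap_in_cuboctahedral_family:
  assumes eq: "equiangular n1 n2 n3" and "\<bar>e\<bar> = 1"
    and x: "x = e *\<^sub>R ((2 / 3) *\<^sub>R (n1 + n2 + n3) - n1)"
  shows "cap x (arctan (3/4)) \<in> cuboctahedral_family n1 n2 n3"
proof -
  obtain a b c where frame: "triangle_frame n1 n2 n3 a b c"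
    and ab: "a \<bullet> b = 1 / 4" "a \<bullet> c = 1 / 4" "b \<bullet> c = 1 / 4"
    using exists_equiangular_frame[OF eq] by metis
  note f = frame[unfolded triangle_frame_def]
  have ee: "e * e = 1" "e \<noteq> 0" using \<open>\<bar>e\<bar> = 1\<close> by (auto simp: abs_if split: if_splits)
  have eey: "e * (e * y) = y" for y using ee(1) by (simp flip: mult.assoc)
  let ?m1 = "(- e) *\<^sub>R n1" and ?m2 = "e *\<^sub>R n2" and ?m3 = "e *\<^sub>R n3"
  let ?p = "(- e) *\<^sub>R a" and ?q = "e *\<^sub>R b" and ?t = "e *\<^sub>R c"
  have signed_frame: "triangle_frame ?m1 ?m2 ?m3 ?p ?q ?t"
    using f \<open>\<bar>e\<bar> = 1\<close> by (simp add: triangle_frame_def eey)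
  have sides: "sph_dist ?p ?q = pi - arccos (1/4)" "sph_dist ?p ?t = pi - arccos (1/4)" "sph_dist ?q ?t = arccos (1/4)"
    by (simp_all add: sph_dist_def ab ee(1) eey arccos_minus)
  have r: "sin (arctan (3/4)) = 3 / 5" "0 < arctan (3/4)" "arctan (3/4) < pi / 2"
    using arctan_ubound by (simp_all add: sin_arctan_3_4)
  have "norm x = 1" "?m1 \<bullet> x = 3 / 5" "?m2 \<bullet> x = 3 / 5" "?m3 \<bullet> x = 3 / 5"
    using eq ee unfolding equiangular_def norm_eq_1 x
    by (simp_all add: inner_expand inner_commute eey)
  then have "inscribed_cap (sph_hull {?p, ?q, ?t}) (cap x (arctan (3/4)))"
    using r eq \<open>\<bar>e\<bar> = 1\<close> by (intro triangle_frame_inscribed_cap[OF signed_frame]) (simp_all add: equiangular_def)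
  moreover have "great_circle ?m1 = great_circle n1" "great_circle ?m2 = great_circle n2" "great_circle ?m3 = great_circle n3"
    using \<open>\<bar>e\<bar> = 1\<close> by (simp_all only: great_circle_scaleR_sign abs_minus_cancel)
  then have "sph_hull {?p, ?q, ?t} \<in> regions {great_circle n1, great_circle n2, great_circle n3}"
    using triangle_frame_region[OF signed_frame] by metis
  moreover have "triangle_with_sides (pi - arccos (1/4)) (pi - arccos (1/4)) (arccos (1/4)) (sph_hull {?p, ?q, ?t})"
    unfolding triangle_with_sides_def using triangle_frame_vertices[OF signed_frame] sides by blast
  ultimately show ?thesis unfolding cuboctahedral_family_def by blast
qed

lemma cuboctahedral_family_commute:
  "cuboctahedral_family n2 n1 n3 = cuboctahedral_family n1 n2 n3"
  "cuboctahedral_family n3 n1 n2 = cuboctahedral_family n1 n2 n3"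
  by (simp_all add: cuboctahedral_family_def insert_commute)

text \<open>A further point with the same signs as one of \<open>x1\<close>, \<open>x2\<close>, \<open>x3\<close> may take its place and is then determined by
the normals through \<open>cut_apart_bound\<close>. No point \<open>z\<close> is positive on all three normals, as \<open>n1 + n2 + n3\<close> has
norm \<open>sqrt (9/5)\<close> while its inner product with \<open>z\<close> would be at least \<open>9/5\<close>.\<close>

lemma extremal_margin_centres:
  fixes n1 n2 n3 :: "'a::real_inner"
  assumes mp: "margin_pair (3 / 5) N Y" and Y: "x1 \<in> Y" "x2 \<in> Y" "x3 \<in> Y" and N: "n1 \<in> N" "n2 \<in> N" "n3 \<in> N"
    and cut: "cut_apart (3 / 5) n1 n2 n3 x1 x2 x3" and "y \<in> Y"
  defines "w \<equiv> (2 / 3) *\<^sub>R (n1 + n2 + n3)"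
  shows "equiangular n1 n2 n3 \<and> (\<exists>e. \<bar>e\<bar> = 1 \<and> (\<exists>n\<in>{n1, n2, n3}. y = e *\<^sub>R (w - n)))"
proof -
  note D = margin_pairD[OF mp]
  have unit: "norm n1 = 1" "norm n2 = 1" "norm n3 = 1" "norm x1 = 1" "norm x2 = 1" "norm x3 = 1"
    using D(2,4) Y N by auto
  have eq: "equiangular n1 n2 n3"
    using cut_apart_bound(2)[OF unit cut refl] unit by (simp add: equiangular_def)
  obtain z where z: "z \<in> {y, - y}" and signs: "3/5 \<le> n1 \<bullet> z \<and> 3/5 \<le> n2 \<bullet> z \<and> 3/5 \<le> n3 \<bullet> z \<or>
      n1 \<bullet> z \<le> - (3/5) \<and> 3/5 \<le> n2 \<bullet> z \<and> 3/5 \<le> n3 \<bullet> z \<or>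
      3/5 \<le> n1 \<bullet> z \<and> n2 \<bullet> z \<le> - (3/5) \<and> 3/5 \<le> n3 \<bullet> z \<or>
      3/5 \<le> n1 \<bullet> z \<and> 3/5 \<le> n2 \<bullet> z \<and> n3 \<bullet> z \<le> - (3/5)"
    using margin_pair_sign_cases[OF mp N \<open>y \<in> Y\<close>] by blast
  have "norm z = 1" using z D(4)[OF \<open>y \<in> Y\<close>] by auto
  note cut' = cut[unfolded cut_apart_def cuts_off_def]
  from signs consider "3/5 \<le> n1 \<bullet> z" "3/5 \<le> n2 \<bullet> z" "3/5 \<le> n3 \<bullet> z" | "n1 \<bullet> z \<le> - (3/5)" "3/5 \<le> n2 \<bullet> z" "3/5 \<le> n3 \<bullet> z"
    | "3/5 \<le> n1 \<bullet> z" "n2 \<bullet> z \<le> - (3/5)" "3/5 \<le> n3 \<bullet> z" | "3/5 \<le> n1 \<bullet> z" "3/5 \<le> n2 \<bullet> z" "n3 \<bullet> z \<le> - (3/5)"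
    by blast
  then have "z = w - n1 \<or> z = w - n2 \<or> z = w - n3"
  proof cases
    case 1
    have "(norm (n1 + n2 + n3 - z))\<^sup>2 = 14 / 5 - 2 * (n1 \<bullet> z + n2 \<bullet> z + n3 \<bullet> z)"
      using eq \<open>norm z = 1\<close> unfolding equiangular_def power2_norm_eq_inner norm_eq_1
      by (simp add: inner_expand inner_commute)
    then show ?thesis using 1 zero_le_power2[of "norm (n1 + n2 + n3 - z)"] by argo
  next
    case 2
    then have "cut_apart (3 / 5) n1 n2 n3 z x2 x3"
      using cut' by (simp add: cut_apart_def cuts_off_def)
    from cut_apart_bound(2)[OF unit(1-3) \<open>norm z = 1\<close> unit(5,6) this refl] show ?thesis
      by (simp add: w_def)
  next
    case 3
    then have "cut_apart (3 / 5) n2 n1 n3 z x1 x3"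
      using cut' by (simp add: cut_apart_def cuts_off_def)
    from cut_apart_bound(2)[OF unit(2,1,3) \<open>norm z = 1\<close> unit(4,6) this refl] show ?thesis
      by (simp add: w_def add.commute)
  next
    case 4
    then have "cut_apart (3 / 5) n3 n1 n2 z x1 x2"
      using cut' by (simp add: cut_apart_def cuts_off_def)
    from cut_apart_bound(2)[OF unit(3,1,2) \<open>norm z = 1\<close> unit(4,5) this refl] show ?thesis
      by (simp add: w_def add.commute add.left_commute)
  qed
  moreover have "y = 1 *\<^sub>R z \<or> y = (- 1) *\<^sub>R z" using z by auto
  ultimately have "\<exists>e. \<bar>e\<bar> = 1 \<and> (\<exists>n\<in>{n1, n2, n3}. y = e *\<^sub>R (w - n))"
    by (metis abs_1 abs_minus_cancel insertCI)
  then show ?thesis using eq by blast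
qed

section \<open>Extremal configurations\<close>

lemma separated_image:
  assumes unit: "\<And>p. p \<in> P \<Longrightarrow> norm (f p) = 1" "\<And>n. n \<in> M \<Longrightarrow> norm n = 1"
    and avoid: "\<And>n p. n \<in> M \<Longrightarrow> p \<in> P \<Longrightarrow> s \<le> \<bar>n \<bullet> f p\<bar>"
    and apart: "\<And>p q. p \<in> P \<Longrightarrow> q \<in> P \<Longrightarrow> p \<noteq> q \<Longrightarrow> \<exists>n\<in>M. (n \<bullet> f p) * (n \<bullet> f q) < 0"
  shows "separated s (f ` P)" "inj_on f P"
proof -
  have *: "\<exists>n\<in>avoiding_normals s (f ` P). 0 < n \<bullet> f p \<and> n \<bullet> f q < 0"
    if pq: "p \<in> P" "q \<in> P" "p \<noteq> q" for p q
  proof -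
    obtain n where n: "n \<in> M" "(n \<bullet> f p) * (n \<bullet> f q) < 0" using apart[OF pq] by blast
    then have "n \<in> avoiding_normals s (f ` P)" "- n \<in> avoiding_normals s (f ` P)"
      using unit(2) avoid by (auto simp: avoiding_normals_def)
    then show ?thesis using n(2) by (force simp: mult_less_0_iff)
  qed
  then show "separated s (f ` P)" using unit(1) by (force simp: separated_def)
  show "inj_on f P" using * by (metis (no_types, lifting) inj_onI order_less_asym)
qed

lemma separated_subset:
  assumes "separated s X" "X' \<subseteq> X"
  shows "separated s X'"
proof -
  have "avoiding_normals s X \<subseteq> avoiding_normals s X'" using assms(2) by (auto simp: avoiding_normals_def)
  then show ?thesis using assms unfolding separated_def by (meson subsetD)
qed

lemma axis_orthonormal:
  "norm (axis 1 1 :: point) = 1" "norm (axis 2 1 :: point) = 1" "norm (axis 3 1 :: point) = 1"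
  "axis 1 1 \<bullet> (axis 2 1 :: point) = 0" "axis 1 1 \<bullet> (axis 3 1 :: point) = 0" "axis 2 1 \<bullet> (axis 3 1 :: point) = 0"
  by (simp_all add: inner_axis_axis)

text \<open>The vectors are the rows of the square root of the Gram matrix, which has eigenvalues \<open>6/5\<close>, \<open>6/5\<close> and \<open>3/5\<close>.\<close>

lemma exists_equiangular: "\<exists>n1 n2 n3 :: point. equiangular n1 n2 n3"
proof -
  define e1 e2 e3 :: point where e: "e1 = axis 1 1" "e2 = axis 2 1" "e3 = axis 3 1"
  note o = axis_orthonormal[folded e]
  define a b where ab: "a = sqrt (6 / 5)" "b = (sqrt (3 / 5) - sqrt (6 / 5)) / 3"
  define u where "u = b *\<^sub>R (e1 + e2 + e3)"
  have a: "a * a = 6 / 5" by (simp add: ab)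
  have b: "2 * (a * b) + 3 * (b * b) = - 1 / 5"
    by (simp add: ab field_simps)
  have "equiangular (a *\<^sub>R e1 + u) (a *\<^sub>R e2 + u) (a *\<^sub>R e3 + u)"
    using o a b unfolding equiangular_def norm_eq_1 u_def
    by (simp add: inner_expand inner_commute algebra_simps)
  then show ?thesis by blast
qed

lemma exists_six_separated: "\<exists>X :: point set. finite X \<and> card X = 6 \<and> separated (3 / 5) X"
proof -
  obtain n1 n2 n3 :: point where eq: "equiangular n1 n2 n3" using exists_equiangular by blast
  define w where "w = (2 / 3) *\<^sub>R (n1 + n2 + n3)"
  let ?M = "{n1, n2, n3}" and ?P = "{1, - 1 :: real} \<times> {n1, n2, n3}"
  define f where "f = (\<lambda>(e, m). e *\<^sub>R (w - m))"
  have uw: "n \<bullet> n = 1" "n \<bullet> w = 2 / 5" "w \<bullet> n = 2 / 5" if "n \<in> ?M" for n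
    using that eq unfolding w_def equiangular_def norm_eq_1 by (auto simp: inner_expand inner_commute)
  have ww: "w \<bullet> w = 4 / 5"
    using eq unfolding w_def equiangular_def norm_eq_1 by (simp add: inner_expand inner_commute)
  have nm: "n \<bullet> m = - 1 / 5" if "n \<in> ?M" "m \<in> ?M" "n \<noteq> m" for n m
    using that eq unfolding equiangular_def by (auto simp: inner_commute)
  have distinct: "n1 \<noteq> n2" "n1 \<noteq> n3" "n2 \<noteq> n3" using eq unfolding equiangular_def norm_eq_1 by auto
  have val: "n \<bullet> f (e, m) = e * (if n = m then - 3 / 5 else 3 / 5)" if "n \<in> ?M" "m \<in> ?M" for n m e
    by (simp add: f_def inner_diff_right uw(1,2)[OF that(1)] uw(1,2)[OF that(2)] nm[OF that])
  have "\<exists>n\<in>?M. (n \<bullet> f p) * (n \<bullet> f q) < 0" if pq: "p \<in> ?P" "q \<in> ?P" "p \<noteq> q" for p q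
  proof -
    obtain d k e m where *: "p = (d, k)" "q = (e, m)" "k \<in> ?M" "m \<in> ?M" "d \<in> {1, - 1}" "e \<in> {1, - 1}"
      using pq(1,2) by (elim SigmaE)
    have "d = e \<or> d = - e" using * by auto
    then consider "d = e" "k \<noteq> m" | "d = - e" "k = m" | "d = - e" "k \<noteq> m" using *(1,2) pq(3) by blast
    then show ?thesis
    proof cases
      case 1
      then show ?thesis using * by (intro bexI[of _ k]) (auto simp: val)
    next
      case 2
      then show ?thesis using * by (intro bexI[of _ k]) (auto simp: val)
    next
      case 3
      obtain n where "n \<in> ?M" "n \<noteq> k" "n \<noteq> m" using distinct *(3,4) by auto
      then show ?thesis using * 3 by (intro bexI[of _ n]) (auto simp: val)
    qed
  qed
  moreover have "norm (f p) = 1" if "p \<in> ?P" for p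
  proof -
    obtain e m where *: "p = (e, m)" "m \<in> ?M" "e \<in> {1, - 1}" using \<open>p \<in> ?P\<close> by (elim SigmaE)
    then have "(w - m) \<bullet> (w - m) = 1" using uw[OF *(2)] ww by (simp add: inner_expand)
    then show ?thesis using * by (auto simp: f_def norm_eq_1)
  qed
  moreover have "3 / 5 \<le> \<bar>n \<bullet> f p\<bar>" if "n \<in> ?M" "p \<in> ?P" for n p
    using that(2) val[OF that(1)] by (auto simp: abs_mult)
  moreover have "norm n = 1" if "n \<in> ?M" for n using uw(1)[OF that] by (simp add: norm_eq_1)
  ultimately have "separated (3 / 5) (f ` ?P)" "inj_on f ?P"
    using separated_image[of ?P f ?M "3/5"] by blast+
  moreover have "finite ?P" "card ?P = 6" using distinct by (simp_all add: card_cartesian_product)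
  ultimately show ?thesis by (metis card_image finite_imageI)
qed

lemma exists_eight_separated: "\<exists>X :: point set. finite X \<and> card X = 8 \<and> separated (1 / sqrt 3) X"
proof -
  define e1 e2 e3 :: point where e: "e1 = axis 1 1" "e2 = axis 2 1" "e3 = axis 3 1"
  note o = axis_orthonormal[folded e, unfolded norm_eq_1]
  let ?M = "{e1, e2, e3}" and ?P = "{1, - 1 :: real} \<times> {1, - 1 :: real} \<times> {1, - 1 :: real}"
  define f where "f = (\<lambda>(a, b, c). (1 / sqrt 3) *\<^sub>R (a *\<^sub>R e1 + b *\<^sub>R e2 + c *\<^sub>R e3))"
  have val: "e1 \<bullet> f (a, b, c) = a / sqrt 3" "e2 \<bullet> f (a, b, c) = b / sqrt 3" "e3 \<bullet> f (a, b, c) = c / sqrt 3" for a b c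
    using o by (simp_all add: f_def inner_expand inner_commute)
  have "norm (f p) = 1" if "p \<in> ?P" for p
    using that o by (auto simp: f_def norm_eq_1 inner_expand inner_commute)
  moreover have "norm n = 1" if "n \<in> ?M" for n using that o by (auto simp: norm_eq_1)
  moreover have "1 / sqrt 3 \<le> \<bar>n \<bullet> f p\<bar>" if "n \<in> ?M" "p \<in> ?P" for n p
    using that by (auto simp: val)
  moreover have "\<exists>n\<in>?M. (n \<bullet> f p) * (n \<bullet> f q) < 0" if "p \<in> ?P" "q \<in> ?P" "p \<noteq> q" for p q
    using that by (auto simp: val)
  ultimately have "separated (1 / sqrt 3) (f ` ?P)" "inj_on f ?P"
    using separated_image[of ?P f ?M "1 / sqrt 3"] by blast+
  moreover have "finite ?P" "card ?P = 8" by (simp_all add: card_cartesian_product)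
  ultimately show ?thesis by (metis card_image finite_imageI)
qed

section \<open>Optimal packings\<close>

text \<open>The radius is attained by a subset of \<open>X\<close>, since dropping points only enlarges the set of
admissible normals; the sine is monotone on the range of radii of caps.\<close>

lemma r_STam_eqI:
  fixes X :: "point set"
  assumes X: "finite X" "separated (sin r) X" "k \<le> card X" and r: "0 < r" "r \<le> pi / 2"
    and bound: "\<And>s Z :: point set. 0 < s \<Longrightarrow> separated s Z \<Longrightarrow> card Z = k \<Longrightarrow> finite Z \<Longrightarrow> s \<le> sin r"
    and "0 < k"
  shows "r_STam k = r"
  unfolding r_STam_def
proof (rule Greatest_equality)
  obtain X' where X': "X' \<subseteq> X" "card X' = k" "finite X'"
    using obtain_subset_with_card_n[OF X(3)] by metis
  then have "ts_packing_of k r ((\<lambda>x. cap x r) ` X')"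
    using separated_subset[OF X(2)] r by (intro ts_packing_of_centres) auto
  then show "0 < r \<and> (\<exists>F. ts_packing_of k r F)" using r by blast
  fix q assume "0 < q \<and> (\<exists>F. ts_packing_of k q F)"
  then obtain F where q: "0 < q" "ts_packing_of k q F" by blast
  then have "F \<noteq> {}" using \<open>0 < k\<close> by (auto simp: ts_packing_of_def)
  then have "q \<le> pi / 2" using q(2) by (auto simp: ts_packing_of_def cap_of_radius_def)
  obtain Z :: "point set" where Z: "finite Z" "card Z = k" "separated (sin q) Z"
    using centres_of_ts_packing[OF q(2)] by metis
  have "0 < sin q" using q(1) \<open>q \<le> pi / 2\<close> by (intro sin_gt_zero) auto
  then have "sin q \<le> sin r" using bound Z by blast
  then show "q \<le> r" using q(1) \<open>q \<le> pi / 2\<close> r by (subst (asm) sin_mono_le_eq) auto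
qed

lemma separated_five_cut_apart:
  fixes X :: "'a::real_inner set"
  assumes "separated s X" "0 < s" "5 \<le> card X"
  obtains n1 n2 n3 x1 x2 x3 where "n1 \<in> avoiding_normals s X" "n2 \<in> avoiding_normals s X" "n3 \<in> avoiding_normals s X"
    "x1 \<in> X \<union> uminus ` X" "x2 \<in> X \<union> uminus ` X" "x3 \<in> X \<union> uminus ` X" "cut_apart s n1 n2 n3 x1 x2 x3"
proof -
  have "finite X" using assms(3) by (metis card.infinite not_numeral_le_zero)
  note ex = exists_transverse[OF assms(1,2) this]
  have card2: "card {a, b} \<le> 2" for a b :: 'a by (simp add: card_insert_if)
  obtain a where a: "a \<in> X" using assms(3) by fastforce
  obtain b where b: "b \<in> X" "transverse (avoiding_normals s X) a b"
    using ex[of "{a}"] a assms(3) by auto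
  obtain c where c: "c \<in> X" "transverse (avoiding_normals s X) a c" "transverse (avoiding_normals s X) b c"
    using ex[of "{a, b}"] a b assms(3) card2[of a b] by auto
  have "a \<in> X \<union> uminus ` X" "b \<in> X \<union> uminus ` X" "c \<in> X \<union> uminus ` X" using a b c by auto
  from transverse_imp_cut_apart[OF margin_pair_avoiding_normals[OF assms(1,2)] this b(2) c(2,3)]
  obtain n1 n2 n3 x y z where "n1 \<in> avoiding_normals s X" "n2 \<in> avoiding_normals s X" "n3 \<in> avoiding_normals s X"
    "x \<in> {a, - a}" "y \<in> {b, - b}" "z \<in> {c, - c}" "cut_apart s n1 n2 n3 x y z" by metis
  then show thesis using a b c by (intro that[of n1 n2 n3 x y z]) auto
qed

lemma separated_seven_octant_bound:
  fixes X :: "'a::real_inner set"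
  assumes "separated s X" "0 < s" "7 \<le> card X"
  shows "octant_bound s (avoiding_normals s X)"
proof -
  have "finite X" using assms(3) by (metis card.infinite not_numeral_le_zero)
  note ex = exists_transverse[OF assms(1,2) this]
  have card2: "card {a, b} \<le> 2" "card {a, b, c} \<le> 3" for a b c :: 'a by (simp_all add: card_insert_if)
  obtain a where a: "a \<in> X" using assms(3) by fastforce
  obtain b where b: "b \<in> X" "transverse (avoiding_normals s X) a b"
    using ex[of "{a}"] a assms(3) by auto
  obtain c where c: "c \<in> X" "transverse (avoiding_normals s X) a c" "transverse (avoiding_normals s X) b c"
    using ex[of "{a, b}"] a b assms(3) card2(1)[of a b] by auto
  obtain d where d: "d \<in> X" "transverse (avoiding_normals s X) a d" "transverse (avoiding_normals s X) b d"
      "transverse (avoiding_normals s X) c d"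
    using ex[of "{a, b, c}"] a b c assms(3) card2(2)[of a b c] by auto
  show ?thesis
    using a b c d by (intro four_transverse_imp_octant_bound[OF margin_pair_avoiding_normals[OF assms(1,2)], of a b c d]) auto
qed

lemma separated_five_bound:
  assumes "separated s X" "0 < s" "5 \<le> card X"
  shows "s \<le> 3 / 5"
proof -
  note D = margin_pairD[OF margin_pair_avoiding_normals[OF assms(1,2)]]
  obtain n1 n2 n3 x1 x2 x3 where "n1 \<in> avoiding_normals s X" "n2 \<in> avoiding_normals s X" "n3 \<in> avoiding_normals s X"
    "x1 \<in> X \<union> uminus ` X" "x2 \<in> X \<union> uminus ` X" "x3 \<in> X \<union> uminus ` X" "cut_apart s n1 n2 n3 x1 x2 x3"
    using separated_five_cut_apart[OF assms] by metis
  then show ?thesis using cut_apart_bound(1)[of n1 n2 n3 x1 x2 x3 s] D(2,4) by blast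
qed

lemma separated_seven_bound:
  assumes "separated s X" "0 < s" "7 \<le> card X"
  shows "s \<le> 1 / sqrt 3"
proof (rule power2_le_imp_le)
  show "s\<^sup>2 \<le> (1 / sqrt 3)\<^sup>2"
    using separated_seven_octant_bound[OF assms] by (simp add: octant_bound_def power_divide)
qed simp

text \<open>Since the hypotheses on the normals are symmetric, the three pairs of centres are covered by permuting them.\<close>

lemma five_centres_cuboctahedral:
  assumes sep: "separated (3 / 5) X" and "5 \<le> card X"
  shows "\<exists>F'. cuboctahedral F' \<and> (\<lambda>x. cap x (arctan (3/4))) ` X \<subseteq> F'"
proof -
  have pos: "0 < (3 / 5 :: real)" by simp
  note mp = margin_pair_avoiding_normals[OF sep pos]
  obtain n1 n2 n3 x1 x2 x3 where N: "n1 \<in> avoiding_normals (3/5) X" "n2 \<in> avoiding_normals (3/5) X" "n3 \<in> avoiding_normals (3/5) X"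
    and Y: "x1 \<in> X \<union> uminus ` X" "x2 \<in> X \<union> uminus ` X" "x3 \<in> X \<union> uminus ` X" and cut: "cut_apart (3/5) n1 n2 n3 x1 x2 x3"
    using separated_five_cut_apart[OF sep pos assms(2)] by metis
  note centre = extremal_margin_centres[OF mp Y N cut]
  have eq: "equiangular n1 n2 n3" using centre[OF Y(1)] by blast
  have "cap x (arctan (3/4)) \<in> cuboctahedral_family n1 n2 n3" if "x \<in> X" for x
  proof -
    obtain e where e: "\<bar>e\<bar> = 1" and "x = e *\<^sub>R ((2 / 3) *\<^sub>R (n1 + n2 + n3) - n1) \<or>
        x = e *\<^sub>R ((2 / 3) *\<^sub>R (n1 + n2 + n3) - n2) \<or> x = e *\<^sub>R ((2 / 3) *\<^sub>R (n1 + n2 + n3) - n3)"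
      using centre[of x] \<open>x \<in> X\<close> by blast
    then consider "x = e *\<^sub>R ((2 / 3) *\<^sub>R (n1 + n2 + n3) - n1)" | "x = e *\<^sub>R ((2 / 3) *\<^sub>R (n2 + n1 + n3) - n2)"
      | "x = e *\<^sub>R ((2 / 3) *\<^sub>R (n3 + n1 + n2) - n3)" by (auto simp: add.commute add.left_commute)
    then show ?thesis
      using cap_in_cuboctahedral_family[OF eq e] cap_in_cuboctahedral_family[OF equiangular_commute(1)[OF eq] e]
        cap_in_cuboctahedral_family[OF equiangular_commute(3)[OF eq] e] cuboctahedral_family_commute
      by cases metis+
  qed
  then show ?thesis using cuboctahedral_cuboctahedral_family[OF eq] by blast
qed

lemma seven_centres_octahedral:
  assumes sep: "separated (1 / sqrt 3) X" and "7 \<le> card X"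
  shows "\<exists>F'. octahedral F' \<and> (\<lambda>x. cap x (arcsin (1 / sqrt 3))) ` X \<subseteq> F'"
proof -
  have "octant_bound (1 / sqrt 3) (avoiding_normals (1 / sqrt 3) X)"
    using separated_seven_octant_bound[OF sep] assms(2) by simp
  then obtain n1 n2 n3 where N: "n1 \<in> avoiding_normals (1 / sqrt 3) X" "n2 \<in> avoiding_normals (1 / sqrt 3) X" "n3 \<in> avoiding_normals (1 / sqrt 3) X"
    and orth: "n1 \<bullet> n2 = 0" "n1 \<bullet> n3 = 0" "n2 \<bullet> n3 = 0"
    by (auto simp: octant_bound_def power_divide)
  have unit: "norm n1 = 1" "norm n2 = 1" "norm n3 = 1" using N by (auto simp: avoiding_normals_def)
  have "(\<lambda>x. cap x (arcsin (1 / sqrt 3))) ` X \<subseteq> octahedral_family n1 n2 n3"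
    using N sep by (auto intro!: cap_in_octahedral_family[OF unit orth refl] simp: avoiding_normals_def separated_def)
  moreover have "octahedral (octahedral_family n1 n2 n3)"
    unfolding octahedral_def octahedral_family_def
    using unit orth by (intro exI[of _ n1] exI[of _ n2] exI[of _ n3]) (auto simp: inner_commute)
  ultimately show ?thesis by blast
qed

theorem theorem1:
  fixes k :: nat
  shows "(5 \<le> k \<and> k \<le> 6 \<longrightarrow>
            r_STam k = arctan (3/4) \<and>
            (\<forall>F. k_optimal k F \<longrightarrow> (\<exists>F'. cuboctahedral F' \<and> F \<subseteq> F'))) \<and>
         (7 \<le> k \<and> k \<le> 8 \<longrightarrow>
            r_STam k = arcsin (1 / sqrt 3) \<and>
            (\<forall>F. k_optimal k F \<longrightarrow> (\<exists>F'. octahedral F' \<and> F \<subseteq> F')))"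
proof (intro conjI[of "_ \<longrightarrow> _"] impI)
  assume k: "5 \<le> k \<and> k \<le> 6"
  obtain X :: "point set" where X: "finite X" "card X = 6" "separated (3 / 5) X"
    using exists_six_separated by blast
  have r: "r_STam k = arctan (3/4)"
    using X k arctan_ubound[of "3/4"] separated_five_bound
    by (intro r_STam_eqI[of X]) (auto simp: sin_arctan_3_4)
  moreover have "\<exists>F'. cuboctahedral F' \<and> F \<subseteq> F'" if "k_optimal k F" for F
  proof -
    have "ts_packing_of k (arctan (3/4)) F" using that r by (simp add: k_optimal_def)
    from centres_of_ts_packing[OF this] show ?thesis
      using five_centres_cuboctahedral k by (metis sin_arctan_3_4)
  qed
  ultimately show "r_STam k = arctan (3/4) \<and>
      (\<forall>F. k_optimal k F \<longrightarrow> (\<exists>F'. cuboctahedral F' \<and> F \<subseteq> F'))" by blast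
next
  assume k: "7 \<le> k \<and> k \<le> 8"
  have "- 1 \<le> 1 / sqrt 3" by (rule order.trans[of _ 0]) simp_all
  then have sin: "sin (arcsin (1 / sqrt 3)) = 1 / sqrt 3" and "arcsin (1 / sqrt 3) \<le> pi / 2"
    using arcsin_ubound[of "1 / sqrt 3"] by (simp_all add: sin_arcsin)
  obtain X :: "point set" where X: "finite X" "card X = 8" "separated (1 / sqrt 3) X"
    using exists_eight_separated by blast
  have r: "r_STam k = arcsin (1 / sqrt 3)"
    using X k arcsin_less_arcsin[of 0 "1 / sqrt 3"] \<open>arcsin (1 / sqrt 3) \<le> pi / 2\<close> separated_seven_bound
    by (intro r_STam_eqI[of X]) (auto simp: sin)
  moreover have "\<exists>F'. octahedral F' \<and> F \<subseteq> F'" if "k_optimal k F" for F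
  proof -
    have "ts_packing_of k (arcsin (1 / sqrt 3)) F" using that r by (simp add: k_optimal_def)
    from centres_of_ts_packing[OF this] show ?thesis
      using seven_centres_octahedral k by (metis sin)
  qed
  ultimately show "r_STam k = arcsin (1 / sqrt 3) \<and>
      (\<forall>F. k_optimal k F \<longrightarrow> (\<exists>F'. octahedral F' \<and> F \<subseteq> F'))" by blast
qed

end
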